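(* Let $\mathcal{A}=\{A_1,\dots,A_m\}\subseteq\mathbb{R}^{n\times n}$ be a switched linear system, and let $\beta\in(0,1)$, $\epsilon>0$, $\delta\ge 1$, $W\ge 0$. Assume that there is $\alpha>0$ with $\mu^{\mathrm{mode}}(j)\ge\alpha$ for all $j\in[m]$, and that $\mu^{\mathrm{noise}}(\{w\in\mathbb{R}^n:\|w\|_2>W'\})\le p(W')$ for all $W'\ge 0$. Let $\omega_N=\{(x_i,j_i,w_i)\}_{i=1}^N$ be sampled i.i.d. according to $\pi$ and let $\mathcal{D}=\{(x_i,y_i)\}_{i=1}^N$ with $y_i=A_{j_i}x_i+w_i$. Let $\overline\rho$ be the output of the indirect data-driven stability certification algorithm (described in the context) run on $\mathcal{D}$, $\epsilon$, $\beta$, with an arbitrary system identification procedure. Then, with confidence $1-\beta$ on the sampling of $\omega_N$, $\rho(\mathcal{A})\le\overline\rho$; that is, $$\pi^N\big(\{\omega_N\in\Delta^N:\rho(\mathcal{A})\le\overline\rho\}\big)\ge 1-\beta.$$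
   Context: Let $n\ge 2$, $m\ge 1$, $[m]=\{1,\dots,m\}$, and $\mathbb{S}^{n-1}$ the Euclidean unit sphere of $\mathbb{R}^n$. A trajectory of $\mathcal{A}$ is a function $\xi:\mathbb{N}\to\mathbb{R}^n$ with $\xi(t+1)\in\{A\xi(t):A\in\mathcal{A}\}$ for all $t$. The joint spectral radius $\rho(\mathcal{A})$ is the infimum of all $r\ge 0$ for which there is $C\ge 1$ such that every trajectory satisfies $\|\xi(t)\|\le Cr^t\|\xi(0)\|$ for all $t\in\mathbb{N}$. For a symmetric positive definite $P$, $\|x\|_P=(x^\top Px)^{1/2}$. For a finite set of matrices $\mathcal{B}$, $\gamma(P,\mathcal{B})=\max_{x\ne 0,\,B\in\mathcal{B}}\|Bx\|_P/\|x\|_P$, $\rho_{\mathrm{quad}}(\mathcal{B},\delta)=\min\{\gamma(P,\mathcal{B}):P\text{ symmetric},\ I\preceq P\preceq\delta I\}$, and $P_0(\mathcal{B},\delta)$ is a minimizer (chosen by a fixed tie-breaking rule if not unique). Probability setting: $\Delta=\mathbb{S}^{n-1}\times[m]\times\mathcal{W}$ with $\mathcal{W}\subseteq\mathbb{R}^n$ the set of noise values, and $\pi=\mu^{\mathrm{state}}\times\mu^{\mathrm{mode}}\times\mu^{\mathrm{noise}}$ is a product probability distribution on $\Delta$, where $\mu^{\mathrm{state}}$ is the uniform distribution on $\mathbb{S}^{n-1}$. The function $p:[0,\infty)\to[0,1]$ is a given tail bound. All maps of the samples below are taken to be measurable. The algorithm. The dataset $\mathcal{D}$ is split, in a way fixed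 in advance, into a training part and a test part with index set $T\subseteq[N]$, $|T|=N_2\ge 1$. (1) Learn a model $\hat{\mathcal{A}}=\{\hat A_1,\dots,\hat A_m\}\subseteq\mathbb{R}^{n\times n}$ from the training part, by any procedure. (2) Let $F=\#\{i\in T:\min_{k\in[m]}\|\hat A_kx_i-y_i\|_2>\epsilon\}$ and let $\hat q$ be the unique $q\in[0,1]$ with $\sum_{l=0}^{F}\binom{N_2}{l}q^l(1-q)^{N_2-l}=\beta$ (with $\hat q=1$ if $F=N_2$). (3) Compute $P=P_0(\hat{\mathcal{A}},\delta)$ and $\rho_{\mathrm{quad}}(\hat{\mathcal{A}},\delta)$. (4) Output $$\overline\rho=\frac{\rho_{\mathrm{quad}}(\hat{\mathcal{A}},\delta)+(\epsilon+W)\sqrt{\overline\kappa(P)}}{\zeta\!\left(\frac{\hat q}{2(1-p(W))\alpha}\,\kappa(P)\right)},$$ where $\overline\kappa(P)=\lambda_{\max}(P)/\lambda_{\min}(P)$, $\kappa(P)=\sqrt{\det(P)/\lambda_{\min}(P)^n}$. Here $\zeta(x)=\sqrt{1-I^{-1}(2x;(n-1)/2;1/2)}$, where $I(x;a;b)=\int_0^xt^{a-1}(1-t)^{b-1}\,dt\big/\int_0^1t^{a-1}(1-t)^{b-1}\,dt$ is the regularized incomplete beta function and $I^{-1}(\cdot;a;b):[0,1]\to[0,1]$ is its inverse in the first variable; thus $\zeta$ is defined for $0\le x\le 1/2$. Convention: $\overline\rho=+\infty$ if $p(W)=1$ or the argument of $\zeta$ is $\ge 1/2$. *)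

theory Defs
  imports "HOL-Probability.Probability"
begin

definition trajectory :: "(real^'n^'n) set \<Rightarrow> (nat \<Rightarrow> real^'n) \<Rightarrow> bool" where
  "trajectory \<A> \<xi> \<longleftrightarrow> (\<forall>t. \<xi> (Suc t) \<in> {A *v \<xi> t | A. A \<in> \<A>})"

definition joint_spectral_radius :: "(real^'n^'n) set \<Rightarrow> real" where
  "joint_spectral_radius \<A> =
     Inf {r. 0 \<le> r \<and> (\<exists>C\<ge>1. \<forall>\<xi>. trajectory \<A> \<xi> \<longrightarrow> (\<forall>t. norm (\<xi> t) \<le> C * r ^ t * norm (\<xi> 0)))}"

definition pos_semidef :: "real^'n^'n \<Rightarrow> bool" where
  "pos_semidef M \<longleftrightarrow> transpose M = M \<and> (\<forall>x. 0 \<le> x \<bullet> (M *v x))"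

definition loewner_le :: "real^'n^'n \<Rightarrow> real^'n^'n \<Rightarrow> bool" where
  "loewner_le M M' \<longleftrightarrow> pos_semidef (M' - M)"

definition quad_norm :: "real^'n^'n \<Rightarrow> real^'n \<Rightarrow> real" where
  "quad_norm P x = sqrt (x \<bullet> (P *v x))"

text \<open>
  For symmetric positive definite \<open>P\<close> and finite nonempty \<open>\<B>\<close> the quotient is bounded, and by
  homogeneity and compactness of the unit sphere the supremum is a maximum.
\<close>
definition quad_gain :: "real^'n^'n \<Rightarrow> (real^'n^'n) set \<Rightarrow> real" where
  "quad_gain P \<B> = Sup {quad_norm P (B *v x) / quad_norm P x | x B. x \<noteq> 0 \<and> B \<in> \<B>}"

definition quad_feasible :: "real \<Rightarrow> real^'n^'n \<Rightarrow> bool" where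
  "quad_feasible \<delta> P \<longleftrightarrow>
     transpose P = P \<and> loewner_le (mat 1) P \<and> loewner_le P (\<delta> *\<^sub>R mat 1)"

text \<open>
  The infimum is a minimum: for \<open>\<delta> \<ge> 1\<close> the feasible set is nonempty and compact, and
  \<open>\<lambda>P. quad_gain P \<B>\<close> is continuous on it.
\<close>
definition rho_quad :: "(real^'n^'n) set \<Rightarrow> real \<Rightarrow> real" where
  "rho_quad \<B> \<delta> = Inf {quad_gain P \<B> | P. quad_feasible \<delta> P}"

definition rho_quad_minimizer :: "(real^'n^'n) set \<Rightarrow> real \<Rightarrow> real^'n^'n \<Rightarrow> bool" where
  "rho_quad_minimizer \<B> \<delta> P \<longleftrightarrow>
     quad_feasible \<delta> P \<and> (\<forall>P'. quad_feasible \<delta> P' \<longrightarrow> quad_gain P \<B> \<le> quad_gain P' \<B>)"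

definition eigenvalues :: "real^'n^'n \<Rightarrow> real set" where
  "eigenvalues P = {l. \<exists>v. v \<noteq> 0 \<and> P *v v = l *\<^sub>R v}"

definition lambda_max :: "real^'n^'n \<Rightarrow> real" where
  "lambda_max P = Max (eigenvalues P)"

definition lambda_min :: "real^'n^'n \<Rightarrow> real" where
  "lambda_min P = Min (eigenvalues P)"

definition kappa_bar :: "real^'n^'n \<Rightarrow> real" where
  "kappa_bar P = lambda_max P / lambda_min P"

definition kappa :: "real^'n^'n \<Rightarrow> real" where
  "kappa P = sqrt (det P / lambda_min P ^ CARD('n))"

text \<open>
  \<open>0 powr c = 0\<close> in HOL for every \<open>c\<close>, so the integrand is off only at the endpoints, a null set.
\<close>
definition reg_inc_beta :: "real \<Rightarrow> real \<Rightarrow> real \<Rightarrow> real" where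
  "reg_inc_beta x a b =
     integral {0..x} (\<lambda>t. t powr (a - 1) * (1 - t) powr (b - 1)) /
     integral {0..1} (\<lambda>t. t powr (a - 1) * (1 - t) powr (b - 1))"

definition inv_reg_inc_beta :: "real \<Rightarrow> real \<Rightarrow> real \<Rightarrow> real" where
  "inv_reg_inc_beta y a b = the_inv_into {0..1} (\<lambda>x. reg_inc_beta x a b) y"

definition zeta :: "nat \<Rightarrow> real \<Rightarrow> real" where
  "zeta n x = sqrt (1 - inv_reg_inc_beta (2 * x) ((real n - 1) / 2) (1 / 2))"

text \<open>
  The normalised surface measure of the unit sphere: \<open>sgn x = x /\<^sub>R norm x\<close> pushes the uniform
  distribution on the unit ball forward to the sphere (the exceptional point \<open>sgn 0 = 0\<close> carries
  no mass and is removed by the restriction).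
\<close>
definition uniform_sphere :: "(real^'n) measure" where
  "uniform_sphere =
     restrict_space (distr (uniform_measure lborel (ball 0 1)) borel sgn) (sphere 0 1)"

definition sample_measure ::
  "nat measure \<Rightarrow> (real^'n) measure \<Rightarrow> ((real^'n) \<times> nat \<times> (real^'n)) measure" where
  "sample_measure \<mu>mode \<mu>noise = uniform_sphere \<Otimes>\<^sub>M (\<mu>mode \<Otimes>\<^sub>M \<mu>noise)"

definition iid_samples ::
  "nat \<Rightarrow> nat measure \<Rightarrow> (real^'n) measure \<Rightarrow> (nat \<Rightarrow> (real^'n) \<times> nat \<times> (real^'n)) measure" where
  "iid_samples N \<mu>mode \<mu>noise = PiM {1..N} (\<lambda>_. sample_measure \<mu>mode \<mu>noise)"

definition dataset ::
  "nat \<Rightarrow> (nat \<Rightarrow> real^'n^'n) \<Rightarrow> (nat \<Rightarrow> (real^'n) \<times> nat \<times> (real^'n)) \<Rightarrow> nat \<Rightarrow> (real^'n) \<times> (real^'n)" where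
  "dataset N A \<omega> = (\<lambda>i\<in>{1..N}. case \<omega> i of (x, j, w) \<Rightarrow> (x, A j *v x + w))"

text \<open>
  A data set is a family of pairs \<open>(x\<^sub>i, y\<^sub>i)\<close> indexed by \<open>{1..N}\<close>; \<open>T\<close> is the set of test indices,
  and the identification procedure \<open>learn\<close> sees only the data outside \<open>T\<close>.
\<close>
definition learned_model ::
  "nat \<Rightarrow> nat set \<Rightarrow> ((nat \<Rightarrow> (real^'n) \<times> (real^'n)) \<Rightarrow> nat \<Rightarrow> real^'n^'n)
   \<Rightarrow> (nat \<Rightarrow> (real^'n) \<times> (real^'n)) \<Rightarrow> nat \<Rightarrow> real^'n^'n" where
  "learned_model N T learn D = learn (restrict D ({1..N} - T))"

definition violation_count ::
  "nat \<Rightarrow> nat set \<Rightarrow> real \<Rightarrow> (nat \<Rightarrow> real^'n^'n) \<Rightarrow> (nat \<Rightarrow> (real^'n) \<times> (real^'n)) \<Rightarrow> nat" where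
  "violation_count m T \<epsilon> Ahat D =
     card {i \<in> T. Min ((\<lambda>k. norm (Ahat k *v fst (D i) - snd (D i))) ` {1..m}) > \<epsilon>}"

definition q_hat :: "nat \<Rightarrow> real \<Rightarrow> nat \<Rightarrow> real" where
  "q_hat N2 \<beta> F =
     (if F = N2 then 1
      else THE q. q \<in> {0..1} \<and> (\<Sum>l=0..F. real (N2 choose l) * q ^ l * (1 - q) ^ (N2 - l)) = \<beta>)"

definition certified_bound ::
  "nat \<Rightarrow> nat \<Rightarrow> nat set \<Rightarrow> ((nat \<Rightarrow> (real^'n) \<times> (real^'n)) \<Rightarrow> nat \<Rightarrow> real^'n^'n)
   \<Rightarrow> ((real^'n^'n) set \<Rightarrow> real \<Rightarrow> real^'n^'n) \<Rightarrow> (real \<Rightarrow> real)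
   \<Rightarrow> real \<Rightarrow> real \<Rightarrow> real \<Rightarrow> real \<Rightarrow> real \<Rightarrow> (nat \<Rightarrow> (real^'n) \<times> (real^'n)) \<Rightarrow> ereal" where
  "certified_bound m N T learn P0 p \<alpha> \<beta> \<epsilon> \<delta> W D =
     (let Ahat = learned_model N T learn D;
          q = q_hat (card T) \<beta> (violation_count m T \<epsilon> Ahat D);
          P = P0 (Ahat ` {1..m}) \<delta>;
          arg = q / (2 * (1 - p W) * \<alpha>) * kappa P
      in if p W = 1 \<or> arg \<ge> 1 / 2 then \<infinity>
         else ereal ((rho_quad (Ahat ` {1..m}) \<delta> + (\<epsilon> + W) * sqrt (kappa_bar P))
                     / zeta CARD('n) arg))"

end

theory Submission
  imports Defs
begin

text \<open>
  The argument separates a deterministic statement about a fixed model from a statistical one.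

  Fix a model and a positive definite \<open>P\<close>, and let \<open>L\<close> be the numerator of the certificate. If a direction
  \<open>x\<close> on the sphere is stretched by a true matrix \<open>A j\<close> by more than \<open>L\<close> in the \<open>P\<close>-norm, then every learned
  matrix is off by more than \<open>\<epsilon> + W\<close> at \<open>x\<close>, so the sample is a misfit whenever mode \<open>j\<close> is drawn and the noise
  is at most \<open>W\<close> (\<open>violating_directions_le_misfit\<close>). Hence if misfits have probability at most \<open>q\<close>, such
  directions have measure at most \<open>q / (\<alpha> (1 - p W))\<close>. In coordinates in which the \<open>P\<close>-norm is Euclidean, a map
  that stretches some vector by \<open>r\<close> stretches every vector in a double cap of height \<open>c\<close> around a suitable axis
  by at least \<open>c r\<close>. The change of coordinates distorts the measure of sets of directions by at most \<open>kappa P\<close>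
  (\<open>measure_ellipsoidal_image_ge\<close>), and the measure of the cap is a regularised incomplete beta function
  (\<open>measure_double_cap\<close>), whose inverse defines \<open>zeta\<close>. Comparing the two, every direction is stretched by at
  most \<open>L / zeta\<close> (\<open>quad_norm_le_of_rare_violations\<close>), so that the \<open>P\<close>-norm is a common Lyapunov function and
  bounds the joint spectral radius (\<open>joint_spectral_radius_le\<close>).

  The model depends only on the training samples, which are independent of the test samples. Conditionally on
  the training part, the number of violations is binomial, and \<open>q_hat\<close> is the Clopper-Pearson upper confidence
  limit for the misfit probability (\<open>clopper_pearson\<close>): it is too small with probability at most \<open>\<beta>\<close>.
  Integrating over the training part gives the theorem.
\<close>

section \<open>Positive definite matrices and their norms\<close>

lemma dot_vector_matrix_mult: "x \<bullet> (y v* R) = (R *v x) \<bullet> y" for R :: "real^'n^'m"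
  by (metis dot_lmul_matrix inner_commute)

lemma symmetric_matrix_dot:
  fixes Q :: "real^'n^'n"
  assumes "transpose Q = Q"
  shows "x \<bullet> (Q *v y) = (Q *v x) \<bullet> y"
  using dot_vector_matrix_mult[of x y Q] by (metis assms transpose_matrix_vector)

text \<open>A small step from \<open>x\<close> in the direction \<open>- Q x\<close> decreases the form to first order unless \<open>Q x = 0\<close>,
  and a nonnegative form cannot decrease from zero.\<close>
lemma psd_zero_imp_kernel:
  fixes Q :: "real^'n^'n"
  assumes sym: "transpose Q = Q" and psd: "\<And>x. 0 \<le> x \<bullet> (Q *v x)" and z: "x \<bullet> (Q *v x) = 0"
  shows "Q *v x = 0"
proof (rule ccontr)
  assume ne: "Q *v x \<noteq> 0"
  define y where "y = Q *v x"
  define a where "a = y \<bullet> y"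
  define b where "b = y \<bullet> (Q *v y)"
  have a: "a > 0" using ne by (simp add: a_def y_def)
  have b: "b \<ge> 0" using psd by (simp add: b_def)
  \<comment> \<open>Short enough for the linear term \<open>2 t a\<close> to beat the quadratic term \<open>t\<^sup>2 b\<close>.\<close>
  define t where "t = - a / (b + 1)"
  have xy: "x \<bullet> (Q *v y) = a"
    using symmetric_matrix_dot[OF sym, of x y] by (simp add: y_def a_def)
  have Qt: "Q *v (x + t *\<^sub>R y) = y + t *\<^sub>R (Q *v y)"
    by (simp add: matrix_vector_right_distrib matrix_vector_mult_scaleR y_def)
  have xyz: "x \<bullet> y = 0" using z by (simp add: y_def)
  have "(x + t *\<^sub>R y) \<bullet> (Q *v (x + t *\<^sub>R y)) = 2 * t * a + t\<^sup>2 * b"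
    unfolding Qt by (simp add: inner_add_left inner_add_right xy xyz a_def[symmetric] b_def[symmetric]
        power2_eq_square algebra_simps)
  also have "\<dots> = - (a\<^sup>2 * (b + 2) / (b + 1)\<^sup>2)"
    using b by (simp add: t_def divide_simps power2_eq_square) (simp add: algebra_simps)
  also have "\<dots> < 0" using a b by (simp add: zero_less_divide_iff)
  finally show False using psd[of "x + t *\<^sub>R y"] by simp
qed

text \<open>If \<open>l\<close> is the maximum of the form on the unit sphere, attained at \<open>v\<close>, then \<open>l I - P\<close> is positive
  semidefinite and its form vanishes at \<open>v\<close>; hence \<open>v\<close> lies in the kernel, i.e. it is an eigenvector.\<close>
lemma rayleigh_max_eigenvalue:
  fixes P :: "real^'n^'n"
  assumes sym: "transpose P = P"
  obtains l where "l \<in> eigenvalues P" "\<And>x. x \<bullet> (P *v x) \<le> l * (x \<bullet> x)"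
proof -
  have "continuous_on (sphere 0 1) (\<lambda>x. x \<bullet> (P *v x))"
    by (intro continuous_intros matrix_vector_mult_linear_continuous_on)
  then obtain v where v: "v \<in> sphere 0 1" "\<And>y. y \<in> sphere 0 1 \<Longrightarrow> y \<bullet> (P *v y) \<le> v \<bullet> (P *v v)"
    using continuous_attains_sup[of "sphere (0::real^'n) 1" "\<lambda>x. x \<bullet> (P *v x)"] by auto
  define l where "l = v \<bullet> (P *v v)"
  have le: "x \<bullet> (P *v x) \<le> l * (x \<bullet> x)" for x
  proof (cases "x = 0")
    case False
    have "(x /\<^sub>R norm x) \<bullet> (P *v (x /\<^sub>R norm x)) \<le> l"
      unfolding l_def by (rule v) (use False in simp)
    then show ?thesis using False
      by (simp add: matrix_vector_mult_scaleR divide_simps power2_norm_eq_inner[symmetric] power2_eq_square)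
  qed simp
  define Q where "Q = l *\<^sub>R mat 1 - P"
  have Qx: "Q *v x = l *\<^sub>R x - P *v x" for x
    by (simp add: Q_def matrix_vector_mult_diff_rdistrib scaleR_matrix_vector_assoc[symmetric])
  have "Q *v v = 0"
  proof (rule psd_zero_imp_kernel)
    show "transpose Q = Q"
      using sym by (simp add: Q_def transpose_def vec_eq_iff mat_def)
    show "0 \<le> x \<bullet> (Q *v x)" for x
      using le[of x] by (simp add: Qx inner_diff_right)
    have "v \<bullet> v = 1" using v(1) by (simp add: power2_norm_eq_inner[symmetric])
    then show "v \<bullet> (Q *v v) = 0" by (simp add: Qx inner_diff_right l_def)
  qed
  then have "P *v v = l *\<^sub>R v" by (simp add: Qx)
  moreover have "v \<noteq> 0" using v(1) by auto
  ultimately have "l \<in> eigenvalues P" by (auto simp: eigenvalues_def)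
  with le that show ?thesis by blast
qed

lemma uminus_matrix_vector_mult: "(- P) *v x = - (P *v x)" for P :: "real^'n^'m"
  by (simp add: matrix_vector_mult_def vec_eq_iff sum_negf)

lemma eigenvalues_uminus: "eigenvalues (- P) = uminus ` eigenvalues P"
proof -
  have e: "(- P) *v v = l *\<^sub>R v \<longleftrightarrow> P *v v = (- l) *\<^sub>R v" for v l
    by (auto simp: uminus_matrix_vector_mult minus_equation_iff[of "P *v v"])
  have "l \<in> eigenvalues (- P) \<longleftrightarrow> - l \<in> eigenvalues P" for l
    by (simp only: eigenvalues_def mem_Collect_eq e)
  note * = this
  have "x \<in> uminus ` eigenvalues P \<longleftrightarrow> - x \<in> eigenvalues P" for x
    using image_eqI[of x uminus "- x" "eigenvalues P"] by auto
  with * show ?thesis by blast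
qed

text \<open>Eigenvectors of different eigenvalues are orthogonal, hence independent. Finiteness is what makes
  \<open>Max\<close> and \<open>Min\<close> of the set of eigenvalues meaningful.\<close>
lemma finite_eigenvalues:
  fixes P :: "real^'n^'n"
  assumes sym: "transpose P = P"
  shows "finite (eigenvalues P)"
proof -
  obtain f where f: "\<And>l. l \<in> eigenvalues P \<Longrightarrow> f l \<noteq> 0 \<and> P *v f l = l *\<^sub>R f l"
    using bchoice[of "eigenvalues P" "\<lambda>l v. v \<noteq> 0 \<and> P *v v = l *\<^sub>R v"]
    by (auto simp: eigenvalues_def)
  have orth: "f k \<bullet> f l = 0" if "k \<in> eigenvalues P" "l \<in> eigenvalues P" "k \<noteq> l" for k l
    using symmetric_matrix_dot[OF sym, of "f k" "f l"] f[OF that(1)] f[OF that(2)] that(3) by simp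
  have inj: "inj_on f (eigenvalues P)"
  proof (rule inj_onI, rule ccontr)
    fix k l assume kl: "k \<in> eigenvalues P" "l \<in> eigenvalues P" "f k = f l" "k \<noteq> l"
    then have "f k \<bullet> f k = 0" using orth[of k l] by simp
    then show False using f[OF kl(1)] by simp
  qed
  have "pairwise orthogonal (f ` eigenvalues P)"
    unfolding pairwise_def orthogonal_def using orth by auto
  moreover have "0 \<notin> f ` eigenvalues P" using f by force
  ultimately have "independent (f ` eigenvalues P)"
    by (intro pairwise_orthogonal_independent)
  then have "finite (f ` eigenvalues P)" by (rule independent_imp_finite)
  then show ?thesis using inj by (simp add: finite_image_iff)
qed

text \<open>The lower bound is the upper bound for \<open>- P\<close>.\<close>
lemma rayleigh_bounds:
  fixes P :: "real^'n^'n"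
  assumes sym: "transpose P = P"
  shows "lambda_min P \<in> eigenvalues P" "lambda_min P * (x \<bullet> x) \<le> x \<bullet> (P *v x)"
    and "x \<bullet> (P *v x) \<le> lambda_max P * (x \<bullet> x)"
proof -
  have fin: "finite (eigenvalues P)" by (rule finite_eigenvalues[OF sym])
  obtain l where l: "l \<in> eigenvalues P" "\<And>x. x \<bullet> (P *v x) \<le> l * (x \<bullet> x)"
    using rayleigh_max_eigenvalue[OF sym] by blast
  have "transpose (- P) = - P" using sym by (simp add: transpose_def vec_eq_iff)
  then obtain k where k: "k \<in> eigenvalues (- P)" "\<And>x. x \<bullet> ((- P) *v x) \<le> k * (x \<bullet> x)"
    using rayleigh_max_eigenvalue by blast
  show "lambda_min P \<in> eigenvalues P"
    unfolding lambda_min_def using fin l(1) by (intro Min_in) auto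
  have "lambda_min P \<le> - k" "l \<le> lambda_max P"
    using fin l(1) k(1) by (auto simp: lambda_min_def lambda_max_def eigenvalues_uminus)
  then have "lambda_min P * (x \<bullet> x) \<le> - k * (x \<bullet> x)" "l * (x \<bullet> x) \<le> lambda_max P * (x \<bullet> x)"
    by (intro mult_right_mono inner_ge_zero; simp)+
  then show "lambda_min P * (x \<bullet> x) \<le> x \<bullet> (P *v x)" "x \<bullet> (P *v x) \<le> lambda_max P * (x \<bullet> x)"
    using k(2)[of x] l(2)[of x] by (auto simp: uminus_matrix_vector_mult)
qed

text \<open>Gram-Schmidt for the inner product of \<open>P\<close>: as long as the family is smaller than the dimension,
  some vector lies outside its span, and what remains of it after projection can be normalised.\<close>
lemma pos_def_orthonormal_family:
  fixes P :: "real^'n^'n"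
  assumes sym: "transpose P = P" and pos: "\<And>x. x \<noteq> 0 \<Longrightarrow> 0 < x \<bullet> (P *v x)"
    and "k \<le> CARD('n)"
  shows "\<exists>S. finite S \<and> card S = k \<and> (\<forall>x\<in>S. \<forall>y\<in>S. x \<bullet> (P *v y) = (if x = y then 1 else 0))"
  using assms(3)
proof (induction k)
  case 0
  show ?case by (rule exI[of _ "{}"]) simp
next
  case (Suc k)
  then obtain S where S: "finite S" "card S = k"
    "\<And>x y. x \<in> S \<Longrightarrow> y \<in> S \<Longrightarrow> x \<bullet> (P *v y) = (if x = y then 1 else 0)" by auto
  have "dim (span S) \<le> k" using dim_le_card'[OF S(1)] S(2) by simp
  then have "dim (span S) \<noteq> dim (UNIV :: (real^'n) set)" using Suc.prems by auto
  then have "span S \<noteq> UNIV" by metis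
  then obtain z where z: "z \<notin> span S" by auto
  define y where "y = z - (\<Sum>s\<in>S. (s \<bullet> (P *v z)) *\<^sub>R s)"
  have "(\<Sum>s\<in>S. (s \<bullet> (P *v z)) *\<^sub>R s) \<in> span S"
    by (intro span_sum span_scale span_base)
  then have ys: "y \<notin> span S" unfolding y_def using z span_add by fastforce
  then have y0: "y \<noteq> 0" using span_zero by metis
  have orth: "s \<bullet> (P *v y) = 0" if "s \<in> S" for s
  proof -
    have "s \<bullet> (P *v y) = s \<bullet> (P *v z) - (\<Sum>t\<in>S. (t \<bullet> (P *v z)) * (s \<bullet> (P *v t)))"
      by (simp add: y_def matrix_vector_mult_diff_distrib inner_diff_right
          matrix_vector_mult_scaleR inner_sum_right linear_sum[OF matrix_vector_mul_linear])
    also have "(\<Sum>t\<in>S. (t \<bullet> (P *v z)) * (s \<bullet> (P *v t))) = (\<Sum>t\<in>S. if t = s then s \<bullet> (P *v z) else 0)"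
      by (intro sum.cong) (use S(3) that in auto)
    finally show ?thesis using S(1) that by simp
  qed
  define c where "c = sqrt (y \<bullet> (P *v y))"
  define u where "u = y /\<^sub>R c"
  have c: "c > 0" "c\<^sup>2 = y \<bullet> (P *v y)" using pos[OF y0] by (auto simp: c_def)
  have su: "s \<bullet> (P *v u) = 0" "u \<bullet> (P *v s) = 0" if "s \<in> S" for s
    using orth[OF that] symmetric_matrix_dot[OF sym, of u s]
    by (auto simp: u_def matrix_vector_mult_scaleR inner_commute)
  have uu: "u \<bullet> (P *v u) = 1"
  proof -
    have "u \<bullet> (P *v u) = (y \<bullet> (P *v y)) / c\<^sup>2"
      by (simp add: u_def matrix_vector_mult_scaleR field_simps power2_eq_square)
    then show ?thesis using c pos[OF y0] by simp
  qed
  have "u \<notin> S" using su(1)[of u] uu by auto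
  then show ?case
    using S su uu by (intro exI[of _ "insert u S"]) auto
qed

text \<open>A positive definite matrix \<open>P\<close> is a Gram matrix \<open>R\<^sup>T R\<close>: take for \<open>R\<close> the inverse of the matrix
  whose columns are a basis that is orthonormal for the inner product of \<open>P\<close>. The norm of \<open>P\<close> is then
  the Euclidean norm after the change of coordinates \<open>R\<close>.\<close>
lemma pos_def_gram_factorization:
  fixes P :: "real^'n^'n"
  assumes sym: "transpose P = P" and pos: "\<And>x. x \<noteq> 0 \<Longrightarrow> 0 < x \<bullet> (P *v x)"
  obtains R M :: "real^'n^'n" where "R ** M = mat 1" "M ** R = mat 1" "P = transpose R ** R"
proof -
  obtain S where S: "finite S" "card S = CARD('n)"
    "\<And>x y. x \<in> S \<Longrightarrow> y \<in> S \<Longrightarrow> x \<bullet> (P *v y) = (if x = y then 1 else 0)"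
    using pos_def_orthonormal_family[OF sym pos order_refl] by blast
  obtain h where h: "bij_betw h (UNIV :: 'n set) S"
    using S(1,2) finite_same_card_bij[of "UNIV :: 'n set" S] by auto
  define M where "M = (\<chi> i j. h j $ i)"
  have col: "M *v axis j 1 = h j" for j
    by (simp add: M_def vec_eq_iff matrix_vector_mult_def axis_def if_distrib cong: if_cong)
  have ent: "(transpose M ** P ** M) $ i $ j = h i \<bullet> (P *v h j)" for i j
  proof -
    have "(transpose M ** P ** M) $ i $ j = axis i 1 \<bullet> ((transpose M ** P ** M) *v axis j 1)"
      by (simp add: inner_axis' matrix_vector_mul_component column_def matrix_vector_mult_basis)
    also have "\<dots> = axis i 1 \<bullet> (transpose M *v (P *v h j))"
      by (simp add: matrix_vector_mul_assoc[symmetric] col)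
    also have "\<dots> = (M *v axis i 1) \<bullet> (P *v h j)"
      by (simp add: dot_vector_matrix_mult)
    finally show ?thesis by (simp add: col)
  qed
  have "transpose M ** P ** M = mat 1"
  proof -
    have "h i \<bullet> (P *v h j) = (if i = j then 1 else 0)" for i j
      using h S(3)[of "h i" "h j"] by (auto simp: bij_betw_def inj_eq)
    then show ?thesis by (simp add: vec_eq_iff ent mat_def)
  qed
  then have R: "M ** (transpose M ** P) = mat 1" "(transpose M ** P) ** M = mat 1"
    using matrix_left_right_inverse by auto
  have "P = transpose (transpose M ** P) ** (transpose M ** P)"
    using R(1) by (simp add: matrix_transpose_mul sym matrix_mul_assoc[symmetric] matrix_mul_rid)
  with R show ?thesis using that by blast
qed

lemma quad_norm_gram: "quad_norm (transpose R ** R) x = norm (R *v x)"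
proof -
  have "x \<bullet> ((transpose R ** R) *v x) = (R *v x) \<bullet> (R *v x)"
    by (simp add: matrix_vector_mul_assoc[symmetric] dot_vector_matrix_mult)
  then show ?thesis by (simp add: quad_norm_def norm_eq_sqrt_inner)
qed

lemma quad_feasible_bounds:
  assumes "quad_feasible \<delta> P"
  shows "transpose P = P" "x \<bullet> x \<le> x \<bullet> (P *v x)" "x \<bullet> (P *v x) \<le> \<delta> * (x \<bullet> x)"
    "x \<noteq> 0 \<Longrightarrow> 0 < x \<bullet> (P *v x)"
proof -
  show "transpose P = P" and 1: "x \<bullet> x \<le> x \<bullet> (P *v x)" and "x \<bullet> (P *v x) \<le> \<delta> * (x \<bullet> x)"
    using assms
    by (auto simp: quad_feasible_def loewner_le_def pos_semidef_def matrix_vector_mult_diff_rdistrib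
        inner_diff_right scaleR_matrix_vector_assoc[symmetric])
  show "0 < x \<bullet> (P *v x)" if "x \<noteq> 0" using 1 that by (meson inner_gt_zero_iff less_le_trans)
qed

lemma quad_norm_bounds:
  assumes "quad_feasible \<delta> P"
  shows "norm x \<le> quad_norm P x" "quad_norm P x \<le> sqrt \<delta> * norm x"
  using quad_feasible_bounds(2,3)[OF assms, of x]
  by (auto simp: quad_norm_def norm_eq_sqrt_inner real_sqrt_mult[symmetric])

lemma lambda_min_ge_1:
  assumes "quad_feasible \<delta> P" shows "1 \<le> lambda_min P"
proof -
  obtain v where v: "v \<noteq> 0" "P *v v = lambda_min P *\<^sub>R v"
    using rayleigh_bounds(1)[OF quad_feasible_bounds(1)[OF assms]] by (auto simp: eigenvalues_def)
  have "v \<bullet> v \<le> lambda_min P * (v \<bullet> v)"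
    using quad_feasible_bounds(2)[OF assms, of v] v by simp
  then show ?thesis using v(1) by simp
qed

lemma quad_norm_lambda_bounds:
  assumes "quad_feasible \<delta> P"
  shows "sqrt (lambda_min P) * norm x \<le> quad_norm P x" "quad_norm P x \<le> sqrt (lambda_max P) * norm x"
  using rayleigh_bounds(2,3)[OF quad_feasible_bounds(1)[OF assms], of x]
  by (auto simp: quad_norm_def norm_eq_sqrt_inner real_sqrt_mult[symmetric])

lemma quad_norm_nonneg [simp]: "quad_feasible \<delta> P \<Longrightarrow> 0 \<le> quad_norm P x"
  using quad_norm_bounds(1)[of \<delta> P x] norm_ge_zero order_trans by blast

text \<open>The bound by operator norms is needed to know that the supremum in \<open>quad_gain\<close> is taken over a
  bounded set.\<close>
lemma quad_norm_le_gain: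
  fixes P :: "real^'n^'n"
  assumes feas: "quad_feasible \<delta> P" and fin: "finite \<B>" and B: "B \<in> \<B>"
  shows "quad_norm P (B *v x) \<le> quad_gain P \<B> * quad_norm P x"
proof (cases "x = 0")
  case True then show ?thesis by (simp add: quad_norm_def)
next
  case False
  define Q where "Q = {quad_norm P (B *v x) / quad_norm P x | x B. x \<noteq> 0 \<and> B \<in> \<B>}"
  define K where "K = sqrt \<delta> * (\<Sum>B\<in>\<B>. onorm ((*v) B))"
  have "0 \<le> \<delta> * (x \<bullet> x)" using quad_feasible_bounds(2,3)[OF feas, of x]
    by (meson inner_ge_zero order_trans)
  then have \<delta>: "\<delta> \<ge> 0" using False by (metis inner_gt_zero_iff zero_le_mult_iff not_less)
  have nn: "0 \<le> onorm ((*v) B)" for B :: "real^'n^'n"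
    by (simp add: onorm_pos_le matrix_vector_mul_bounded_linear)
  have "bdd_above Q"
  proof (rule bdd_aboveI[of _ K])
    fix q assume "q \<in> Q"
    then obtain y B where q: "q = quad_norm P (B *v y) / quad_norm P y" "y \<noteq> 0" "B \<in> \<B>"
      by (auto simp: Q_def)
    have "quad_norm P (B *v y) \<le> sqrt \<delta> * norm (B *v y)" by (rule quad_norm_bounds(2)[OF feas])
    also have "\<dots> \<le> sqrt \<delta> * (onorm ((*v) B) * norm y)"
      using \<delta> by (intro mult_left_mono onorm matrix_vector_mul_bounded_linear) auto
    also have "\<dots> \<le> sqrt \<delta> * ((\<Sum>B\<in>\<B>. onorm ((*v) B)) * quad_norm P y)"
      using \<delta> nn q(3) fin quad_norm_bounds(1)[OF feas]
      by (intro mult_left_mono mult_mono member_le_sum sum_nonneg) auto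
    finally have "quad_norm P (B *v y) \<le> K * quad_norm P y" by (simp add: K_def mult.assoc)
    moreover have "quad_norm P y > 0"
      using quad_norm_bounds(1)[OF feas, of y] q(2) by (meson less_le_trans zero_less_norm_iff)
    ultimately show "q \<le> K" by (simp add: q(1) divide_simps)
  qed
  then have "quad_norm P (B *v x) / quad_norm P x \<le> quad_gain P \<B>"
    unfolding quad_gain_def Q_def[symmetric] using False B by (intro cSup_upper) (auto simp: Q_def)
  moreover have "quad_norm P x > 0"
    using quad_norm_bounds(1)[OF feas, of x] False by (meson less_le_trans zero_less_norm_iff)
  ultimately show ?thesis by (simp add: divide_simps)
qed

lemma quad_gain_minimizer:
  assumes "rho_quad_minimizer \<B> \<delta> P"
  shows "quad_gain P \<B> = rho_quad \<B> \<delta>"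
  unfolding rho_quad_def
  by (rule cInf_eq_minimum[symmetric]) (use assms in \<open>auto simp: rho_quad_minimizer_def\<close>)

text \<open>A norm that contracts by \<open>r\<close> in every mode is a common Lyapunov function; equivalence with the
  Euclidean norm costs the constant \<open>sqrt \<delta>\<close>.\<close>
lemma joint_spectral_radius_le:
  fixes P :: "real^'n^'n"
  assumes feas: "quad_feasible \<delta> P" and r: "0 \<le> r" and \<delta>: "1 \<le> \<delta>"
    and contr: "\<And>A x. A \<in> \<A> \<Longrightarrow> quad_norm P (A *v x) \<le> r * quad_norm P x"
  shows "joint_spectral_radius \<A> \<le> r"
  unfolding joint_spectral_radius_def
proof (rule cInf_lower)
  have "norm (\<xi> t) \<le> sqrt \<delta> * r ^ t * norm (\<xi> 0)" if tr: "trajectory \<A> \<xi>" for \<xi> t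
  proof -
    have "quad_norm P (\<xi> t) \<le> r ^ t * quad_norm P (\<xi> 0)"
    proof (induction t)
      case (Suc t)
      obtain A where A: "A \<in> \<A>" "\<xi> (Suc t) = A *v \<xi> t" using tr by (auto simp: trajectory_def)
      have "quad_norm P (\<xi> (Suc t)) \<le> r * quad_norm P (\<xi> t)" using contr[OF A(1)] A(2) by simp
      also have "\<dots> \<le> r * (r ^ t * quad_norm P (\<xi> 0))" using Suc r by (rule mult_left_mono)
      finally show ?case by simp
    qed simp
    also have "\<dots> \<le> r ^ t * (sqrt \<delta> * norm (\<xi> 0))"
      using quad_norm_bounds(2)[OF feas] r by (intro mult_left_mono) auto
    finally show ?thesis using quad_norm_bounds(1)[OF feas, of "\<xi> t"] by (simp add: algebra_simps)
  qed
  then show "r \<in> {r. 0 \<le> r \<and> (\<exists>C\<ge>1. \<forall>\<xi>. trajectory \<A> \<xi> \<longrightarrow> (\<forall>t. norm (\<xi> t) \<le> C * r ^ t * norm (\<xi> 0)))}"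
    using r \<delta> by (auto intro!: exI[of _ "sqrt \<delta>"])
  show "bdd_below {r. 0 \<le> r \<and> (\<exists>C\<ge>1. \<forall>\<xi>. trajectory \<A> \<xi> \<longrightarrow> (\<forall>t. norm (\<xi> t) \<le> C * r ^ t * norm (\<xi> 0)))}"
    by (rule bdd_belowI[of _ 0]) auto
qed

section \<open>The measure of a double cap and the incomplete beta function\<close>

lemma borel_measurable_sum_squares_PiM:
  assumes "I \<subseteq> J"
  shows "(\<lambda>f. \<Sum>b\<in>I. (f b)\<^sup>2) \<in> borel_measurable (Pi\<^sub>M J (\<lambda>_. lborel :: real measure))"
proof (rule borel_measurable_sum)
  fix b assume "b \<in> I"
  then have [measurable]: "(\<lambda>f. f b) \<in> borel_measurable (Pi\<^sub>M J (\<lambda>_. lborel :: real measure))"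
    using measurable_component_singleton[of b J "\<lambda>_. lborel :: real measure"] assms by auto
  show "(\<lambda>f. (f b)\<^sup>2) \<in> borel_measurable (Pi\<^sub>M J (\<lambda>_. lborel :: real measure))" by measurable
qed

text \<open>Cavalieri's principle: the slice at height \<open>t\<close> is a ball of radius \<open>R t\<close> in one dimension less,
  and a negative \<open>R t\<close> stands for an empty slice. Radius zero is excluded almost everywhere because the
  volume formula for balls is stated for positive radii.\<close>
lemma emeasure_solid_of_revolution:
  fixes e :: "'a :: euclidean_space" and R :: "real \<Rightarrow> real"
  assumes e: "e \<in> Basis" and dim: "2 \<le> DIM('a)"
    and R[measurable]: "R \<in> borel_measurable borel" and R0: "AE t in lborel. R t \<noteq> 0"
  shows "emeasure lborel {y. sqrt (\<Sum>b\<in>Basis - {e}. (y \<bullet> b)\<^sup>2) \<le> R (y \<bullet> e)} =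
    (\<integral>\<^sup>+t. ennreal (unit_ball_vol (real (DIM('a) - 1)) * max 0 (R t) ^ (DIM('a) - 1)) \<partial>lborel)"
    (is "emeasure lborel ?S = _")
proof -
  interpret product_sigma_finite "\<lambda>_::'a. lborel :: real measure" by standard
  let ?I = "Basis - {e} :: 'a set"
  let ?h = "\<lambda>f. \<Sum>b\<in>Basis. f b *\<^sub>R b :: 'a"
  let ?S' = "{f \<in> space (Pi\<^sub>M Basis (\<lambda>_. lborel)). sqrt (\<Sum>b\<in>?I. (f b)\<^sup>2) \<le> R (f e)}"
  have Basis: "insert e ?I = Basis" using e by auto
  have comp: "?h f \<bullet> b = f b" if "b \<in> Basis" for f b
    using that by (simp add: inner_sum_left inner_Basis if_distrib cong: if_cong)
  have card: "card ?I = DIM('a) - 1" using e by simp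
  have S: "?S \<in> sets borel" by measurable
  have em [measurable]: "(\<lambda>f. f e) \<in> borel_measurable (Pi\<^sub>M Basis (\<lambda>_. lborel))"
    using measurable_component_singleton[of e Basis "\<lambda>_. lborel :: real measure"] e by simp
  have [measurable]: "(\<lambda>f. \<Sum>b\<in>?I. (f b)\<^sup>2) \<in> borel_measurable (Pi\<^sub>M Basis (\<lambda>_. lborel :: real measure))"
    by (rule borel_measurable_sum_squares_PiM) auto
  have S'[measurable]: "?S' \<in> sets (Pi\<^sub>M Basis (\<lambda>_. lborel))" by measurable
  have "emeasure lborel ?S = emeasure (Pi\<^sub>M Basis (\<lambda>_. lborel)) (?h -` ?S \<inter> space (Pi\<^sub>M Basis (\<lambda>_. lborel)))"
  proof (subst lborel_eq, rule emeasure_distr)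
    show "?h \<in> measurable (Pi\<^sub>M Basis (\<lambda>_. lborel)) borel"
    proof (rule borel_measurable_sum)
      fix b :: 'a assume "b \<in> Basis"
      then have [measurable]: "(\<lambda>f. f b) \<in> borel_measurable (Pi\<^sub>M Basis (\<lambda>_. lborel :: real measure))"
        using measurable_component_singleton[of b Basis "\<lambda>_. lborel :: real measure"] by simp
      show "(\<lambda>f. f b *\<^sub>R b) \<in> borel_measurable (Pi\<^sub>M Basis (\<lambda>_. lborel :: real measure))" by measurable
    qed
  qed (use S in simp)
  also have "?h -` ?S \<inter> space (Pi\<^sub>M Basis (\<lambda>_. lborel)) = ?S'"
    using e by (auto simp: comp)
  also have "emeasure (Pi\<^sub>M Basis (\<lambda>_. lborel)) ?S' =
      (\<integral>\<^sup>+f. indicator ?S' f \<partial>Pi\<^sub>M (insert e ?I) (\<lambda>_. lborel))"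
    unfolding Basis by (rule nn_integral_indicator[OF S', symmetric])
  also have "\<dots> = (\<integral>\<^sup>+t. \<integral>\<^sup>+f. indicator ?S' (f(e := t)) \<partial>Pi\<^sub>M ?I (\<lambda>_. lborel) \<partial>lborel)"
  proof (rule product_nn_integral_insert_rev)
    show "indicator ?S' \<in> borel_measurable (Pi\<^sub>M (insert e ?I) (\<lambda>_. lborel))"
      unfolding Basis by (rule borel_measurable_indicator[OF S'])
  qed auto
  also have "\<dots> = (\<integral>\<^sup>+t. ennreal (unit_ball_vol (real (DIM('a) - 1)) * max 0 (R t) ^ (DIM('a) - 1)) \<partial>lborel)"
  proof (intro nn_integral_cong_AE, use R0 in eventually_elim)
    case (elim t)
    let ?D = "{f. sqrt (\<Sum>b\<in>?I. (f b)\<^sup>2) \<le> R t} \<inter> space (Pi\<^sub>M ?I (\<lambda>_. lborel :: real measure))"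
    have "(\<integral>\<^sup>+f. indicator ?S' (f(e := t)) \<partial>Pi\<^sub>M ?I (\<lambda>_. lborel)) = (\<integral>\<^sup>+f. indicator ?D f \<partial>Pi\<^sub>M ?I (\<lambda>_. lborel))"
    proof (intro nn_integral_cong)
      fix f :: "'a \<Rightarrow> real" assume f: "f \<in> space (Pi\<^sub>M ?I (\<lambda>_. lborel))"
      have "(\<Sum>b\<in>?I. ((f(e := t)) b)\<^sup>2) = (\<Sum>b\<in>?I. (f b)\<^sup>2)" by (intro sum.cong) auto
      moreover have "f(e := t) \<in> space (Pi\<^sub>M Basis (\<lambda>_. lborel))"
        using f e by (auto simp: space_PiM PiE_def extensional_def)
      ultimately show "indicator ?S' (f(e := t)) = (indicator ?D f :: ennreal)"
        using f by (simp add: indicator_def)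
    qed
    also have "\<dots> = emeasure (Pi\<^sub>M ?I (\<lambda>_. lborel)) ?D" 
    proof (rule nn_integral_indicator)
      have [measurable]: "(\<lambda>f. \<Sum>b\<in>?I. (f b)\<^sup>2) \<in> borel_measurable (Pi\<^sub>M ?I (\<lambda>_. lborel :: real measure))"
        by (rule borel_measurable_sum_squares_PiM) auto
      have "{f \<in> space (Pi\<^sub>M ?I (\<lambda>_. lborel :: real measure)). sqrt (\<Sum>b\<in>?I. (f b)\<^sup>2) \<le> R t} \<in> sets (Pi\<^sub>M ?I (\<lambda>_. lborel))"
        by measurable
      then show "?D \<in> sets (Pi\<^sub>M ?I (\<lambda>_. lborel))"
        by (simp add: Int_def conj_commute)
    qed
    also have "\<dots> = ennreal (unit_ball_vol (real (DIM('a) - 1)) * max 0 (R t) ^ (DIM('a) - 1))"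
    proof (cases "R t > 0")
      case True
      then show ?thesis using emeasure_cball_aux[of ?I "R t"] card by (simp add: max_def)
    next
      case False
      then have "R t < 0" using elim by simp
      moreover have "0 \<le> sqrt (\<Sum>b\<in>?I. (f b)\<^sup>2)" for f :: "'a \<Rightarrow> real" by (simp add: sum_nonneg)
      ultimately have "\<not> sqrt (\<Sum>b\<in>?I. (f b)\<^sup>2) \<le> R t" for f :: "'a \<Rightarrow> real"
        by (meson not_le order_trans)
      then have "?D = {}" by blast
      then show ?thesis using \<open>R t < 0\<close> dim by (simp add: max_def)
    qed
    finally show ?case .
  qed
  finally show ?thesis .
qed

text \<open>Up to the factor \<open>2 * unit_ball_vol d\<close>, the volume in dimension \<open>d + 1\<close> of the part of the unit ball
  in which the absolute height is at least \<open>c = sqrt (1 - x)\<close> times the norm. In the upper half, the first summand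
  is the cone below height \<open>c\<close>, the second the ball above it.\<close>
definition cap_profile :: "nat \<Rightarrow> real \<Rightarrow> real" where
  "cap_profile d x = sqrt (1 - x) * sqrt x ^ d / (real d + 1) + integral {sqrt (1 - x)..1} (\<lambda>t. sqrt (1 - t\<^sup>2) ^ d)"

lemma continuous_on_sqrt_power: "continuous_on S (\<lambda>t::real. sqrt (1 - t\<^sup>2) ^ d)"
  by (intro continuous_intros)

lemma cap_profile_alt:
  assumes "0 \<le> x" "x \<le> 1"
  shows "cap_profile d x = sqrt (1 - x) * sqrt x ^ d / (real d + 1) +
     (integral {0..1} (\<lambda>t. sqrt (1 - t\<^sup>2) ^ d) - integral {0..sqrt (1 - x)} (\<lambda>t. sqrt (1 - t\<^sup>2) ^ d))"
  using Henstock_Kurzweil_Integration.integral_combine[of 0 "sqrt (1 - x)" 1 "\<lambda>t. sqrt (1 - t\<^sup>2) ^ d"] assms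
    integrable_continuous_real[OF continuous_on_sqrt_power[of "{0..1}" d]]
  by (simp add: cap_profile_def)

lemma continuous_on_cap_profile: "continuous_on {0..1} (cap_profile d)"
proof -
  have "continuous_on {0..1} (\<lambda>c. integral {0..c} (\<lambda>t. sqrt (1 - t\<^sup>2) ^ d))"
    by (intro indefinite_integral_continuous_1 integrable_continuous_real continuous_on_sqrt_power)
  then have "continuous_on {0..1} (\<lambda>x. integral {0..sqrt (1 - x)} (\<lambda>t. sqrt (1 - t\<^sup>2) ^ d))"
    by (rule continuous_on_compose2) (auto intro!: continuous_intros)
  then have "continuous_on {0..1} (\<lambda>x. sqrt (1 - x) * sqrt x ^ d / (real d + 1) +
     (integral {0..1} (\<lambda>t. sqrt (1 - t\<^sup>2) ^ d) - integral {0..sqrt (1 - x)} (\<lambda>t. sqrt (1 - t\<^sup>2) ^ d)))"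
    by (intro continuous_intros) auto
  then show ?thesis
    by (rule continuous_on_cong[THEN iffD1, rotated -1]) (auto simp: cap_profile_alt)
qed

text \<open>The derivative is, up to a constant, the integrand of the incomplete beta function with parameters
  \<open>d / 2\<close> and \<open>1 / 2\<close>. With \<open>s = sqrt x\<close> and \<open>c = sqrt (1 - x)\<close>, the three terms of the derivative combine by
  \<open>c\<^sup>2 + s\<^sup>2 = 1\<close>.\<close>
lemma DERIV_cap_profile:
  assumes x: "0 < x" "x < 1"
  shows "(cap_profile d has_real_derivative
    real d / (2 * (real d + 1)) * (x powr (real d / 2 - 1) * (1 - x) powr (1 / 2 - 1))) (at x)"
proof -
  define c where "c = sqrt (1 - x)"
  define s where "s = sqrt x"
  have c: "0 < c" "c < 1" "c\<^sup>2 = 1 - x" and s: "s > 0" "s\<^sup>2 = x" using x by (auto simp: c_def s_def)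
  let ?G = "\<lambda>c. integral {0..c} (\<lambda>t. sqrt (1 - t\<^sup>2) ^ d)"
  have "(?G has_real_derivative sqrt (1 - c\<^sup>2) ^ d) (at c within {0..1})"
    by (rule integral_has_real_derivative[OF continuous_on_sqrt_power]) (use c in auto)
  then have G: "(?G has_real_derivative s ^ d) (at c)"
    using c s at_within_interior[of c "{0..1}"] by (simp add: s_def)
  have c': "((\<lambda>x. sqrt (1 - x)) has_real_derivative - 1 / (2 * c)) (at x)"
    using x by (auto intro!: derivative_eq_intros simp: c_def field_simps)
  have s': "(sqrt has_real_derivative 1 / (2 * s)) (at x)"
    using x by (auto intro!: derivative_eq_intros simp: s_def field_simps)
  have Gc: "((\<lambda>x. ?G (sqrt (1 - x))) has_real_derivative s ^ d * (- 1 / (2 * c))) (at x)"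
    using DERIV_chain2[OF G[unfolded c_def] c'[unfolded c_def]] by (simp add: c_def)
  have "((\<lambda>x. sqrt (1 - x) * sqrt x ^ d / (real d + 1) + (?G 1 - ?G (sqrt (1 - x)))) has_real_derivative
      (- 1 / (2 * c) * s ^ d + real d * s ^ (d - Suc 0) * (1 / (2 * s)) * c) / (real d + 1) + (0 - s ^ d * (- 1 / (2 * c)))) (at x)"
    using DERIV_mult[OF c' DERIV_power[OF s', of d]]
    by (intro DERIV_add DERIV_diff DERIV_const Gc DERIV_cdivide)
       (simp_all add: c_def[symmetric] s_def[symmetric] algebra_simps)
  moreover have "(- 1 / (2 * c) * s ^ d + real d * s ^ (d - Suc 0) * (1 / (2 * s)) * c) / (real d + 1) + (0 - s ^ d * (- 1 / (2 * c)))
     = real d / (2 * (real d + 1)) * (s ^ d / (c * s\<^sup>2))"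
  proof (cases d)
    case (Suc k)
    have "c * c + s * s = 1" using c(3) s(2) by (simp add: power2_eq_square)
    moreover have "(- 1 / (2 * c) * s ^ d + real d * s ^ (d - Suc 0) * (1 / (2 * s)) * c) / (real d + 1) + (0 - s ^ d * (- 1 / (2 * c)))
      = real d / (2 * (real d + 1)) * (s ^ k * (c * c + s * s) / (c * s))"
      using c(1) s(1) Suc by (simp add: divide_simps) (simp add: algebra_simps)
    ultimately show ?thesis using c(1) s(1) Suc by (simp add: power2_eq_square)
  qed simp
  moreover have "s ^ d / (c * s\<^sup>2) = x powr (real d / 2 - 1) * (1 - x) powr (1 / 2 - 1)"
  proof -
    have "s ^ d = x powr (real d / 2)"
      using x s(1) by (simp add: s_def powr_half_sqrt[symmetric] powr_powr flip: powr_realpow)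
    then have "x powr (real d / 2 - 1) = s ^ d / x" using x by (simp add: powr_diff)
    moreover have "(1 - x) powr (1 / 2 - 1) = 1 / c"
      using x by (simp add: c_def powr_minus powr_half_sqrt divide_simps)
    ultimately show ?thesis using s(2) by simp
  qed
  ultimately have "((\<lambda>x. sqrt (1 - x) * sqrt x ^ d / (real d + 1) + (?G 1 - ?G (sqrt (1 - x)))) has_real_derivative
      real d / (2 * (real d + 1)) * (x powr (real d / 2 - 1) * (1 - x) powr (1 / 2 - 1))) (at x)"
    by simp
  then show ?thesis
    by (rule has_field_derivative_transform_within_open[of _ _ _ "{0<..<1}"])
       (use x in \<open>auto simp: cap_profile_alt\<close>)
qed

lemma cap_profile_0: "0 < d \<Longrightarrow> cap_profile d 0 = 0"
  by (simp add: cap_profile_def)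

lemma cap_profile_strict_mono:
  assumes "0 < d" "0 \<le> x" "x < y" "y \<le> 1"
  shows "cap_profile d x < cap_profile d y"
proof (rule DERIV_pos_imp_increasing_open[where f = "cap_profile d"])
  show "x < y" by fact
  show "\<exists>D. (cap_profile d has_real_derivative D) (at z) \<and> D > 0" if "x < z" "z < y" for z
  proof -
    have z: "0 < z" "z < 1" using that assms by auto
    then have "0 < real d / (2 * (real d + 1)) * (z powr (real d / 2 - 1) * (1 - z) powr (1 / 2 - 1))"
      using \<open>0 < d\<close> by (intro mult_pos_pos divide_pos_pos) auto
    with DERIV_cap_profile[OF z] show ?thesis by blast
  qed
  show "continuous_on {x..y} (cap_profile d)"
    by (rule continuous_on_subset[OF continuous_on_cap_profile]) (use assms in auto)
qed

text \<open>The fundamental theorem of calculus turns both integrals in \<open>reg_inc_beta\<close> into values of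
  \<open>cap_profile\<close>; the constant cancels in the quotient.\<close>
lemma reg_inc_beta_cap_profile:
  assumes d: "0 < d" and x: "0 \<le> x" "x \<le> 1"
  shows "reg_inc_beta x (real d / 2) (1 / 2) = cap_profile d x / cap_profile d 1"
proof -
  define K where "K = real d / (2 * (real d + 1))"
  have K: "K > 0" using d by (simp add: K_def)
  have I: "integral {0..y} (\<lambda>t. t powr (real d / 2 - 1) * (1 - t) powr (1 / 2 - 1)) = cap_profile d y / K"
    if y: "0 \<le> y" "y \<le> 1" for y
  proof -
    have "((\<lambda>t. K * (t powr (real d / 2 - 1) * (1 - t) powr (1 / 2 - 1)))
        has_integral (cap_profile d y - cap_profile d 0)) {0..y}"
    proof (rule fundamental_theorem_of_calculus_interior)
      show "continuous_on {0..y} (cap_profile d)"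
        by (rule continuous_on_subset[OF continuous_on_cap_profile]) (use y in auto)
      show "(cap_profile d has_vector_derivative K * (t powr (real d / 2 - 1) * (1 - t) powr (1 / 2 - 1))) (at t)"
        if "t \<in> {0<..<y}" for t
        unfolding has_real_derivative_iff_has_vector_derivative[symmetric]
        unfolding K_def by (rule DERIV_cap_profile) (use that y in auto)
    qed (use y in auto)
    from has_integral_mult_right[OF this, of "inverse K"] K
    have "((\<lambda>t. t powr (real d / 2 - 1) * (1 - t) powr (1 / 2 - 1)) has_integral
        inverse K * (cap_profile d y)) {0..y}"
      by (simp add: mult.assoc[symmetric] cap_profile_0[OF d])
    then show ?thesis by (simp add: integral_unique field_simps)
  qed
  show ?thesis unfolding reg_inc_beta_def using I[OF x] I[of 1] K by simp
qed

text \<open>In geometric terms, \<open>zeta (d + 1) y\<close> is the height \<open>c\<close> at which the pair of caps above height \<open>c\<close>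
  has normalised measure \<open>2 y\<close>. Lower caps are larger, which is the last claim.\<close>
lemma zeta_cap_height:
  assumes d: "0 < d" and y: "0 \<le> y" "y < 1 / 2"
  shows "0 < zeta (Suc d) y" "zeta (Suc d) y \<le> 1"
    and "\<And>c. 0 \<le> c \<Longrightarrow> c < zeta (Suc d) y \<Longrightarrow> 2 * y < reg_inc_beta (1 - c\<^sup>2) (real d / 2) (1 / 2)"
proof -
  let ?I = "\<lambda>x. reg_inc_beta x (real d / 2) (1 / 2)"
  have pos: "cap_profile d 1 > 0"
    using cap_profile_strict_mono[OF d, of 0 1] cap_profile_0[OF d] by simp
  have mono: "?I x < ?I z" if "0 \<le> x" "x < z" "z \<le> 1" for x z
    using that pos by (simp add: reg_inc_beta_cap_profile[OF d] divide_strict_right_mono cap_profile_strict_mono[OF d])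
  have "continuous_on {0..1} ?I"
  proof -
    have "continuous_on {0..1} (\<lambda>x. cap_profile d x / cap_profile d 1)"
      using pos by (intro continuous_intros continuous_on_cap_profile) auto
    then show ?thesis
      by (rule continuous_on_cong[THEN iffD1, rotated -1]) (auto simp: reg_inc_beta_cap_profile[OF d])
  qed
  moreover have I0: "?I 0 = 0" and I1: "?I 1 = 1" using pos by (simp_all add: reg_inc_beta_cap_profile[OF d] cap_profile_0[OF d])
  ultimately obtain z where z: "0 \<le> z" "z \<le> 1" "?I z = 2 * y"
    using IVT'[of ?I 0 "2 * y" 1] y by auto
  have inj: "inj_on ?I {0..1}"
    by (rule linorder_inj_onI) (use mono in \<open>auto dest: less_imp_neq\<close>)
  have "inv_reg_inc_beta (2 * y) (real d / 2) (1 / 2) = z"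
    unfolding inv_reg_inc_beta_def by (rule the_inv_into_f_eq[OF inj]) (use z in auto)
  then have zeta: "zeta (Suc d) y = sqrt (1 - z)" by (simp add: zeta_def)
  have "z \<noteq> 1" using z I1 y by auto
  then show "0 < zeta (Suc d) y" "zeta (Suc d) y \<le> 1" using z by (auto simp: zeta)
  fix c assume c: "0 \<le> c" "c < zeta (Suc d) y"
  then have "c\<^sup>2 < 1 - z" using z by (metis zeta real_sqrt_less_iff real_sqrt_unique not_less real_less_rsqrt sqrt_le_D linorder_not_le)
  then show "2 * y < ?I (1 - c\<^sup>2)" using mono[of z "1 - c\<^sup>2"] z by auto
qed


text \<open>Reflection symmetry in the height reduces the volume to an integral over \<open>[0, 1]\<close>.\<close>
lemma emeasure_symmetric_solid_of_revolution:
  fixes e :: "'a :: euclidean_space" and r :: "real \<Rightarrow> real"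
  assumes e: "e \<in> Basis" and d: "DIM('a) = Suc d" "0 < d"
    and r[measurable]: "r \<in> borel_measurable borel" and pos: "\<And>t. 0 < t \<Longrightarrow> t < 1 \<Longrightarrow> 0 < r t"
    and r0: "0 \<le> r 0" "0 \<le> r 1"
    and I: "((\<lambda>t. r t ^ d) has_integral I) {0..1}"
  shows "emeasure lborel {y. \<bar>y \<bullet> e\<bar> \<le> 1 \<and> sqrt (\<Sum>b\<in>Basis - {e}. (y \<bullet> b)\<^sup>2) \<le> r \<bar>y \<bullet> e\<bar>} =
    ennreal (2 * unit_ball_vol (real d) * I)"
proof -
  let ?R = "\<lambda>t::real. if \<bar>t\<bar> \<le> 1 then r \<bar>t\<bar> else -1"
  let ?v = "unit_ball_vol (real d)"
  have r_nonneg: "0 \<le> r t" if "0 \<le> t" "t \<le> 1" for t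
    using that pos[of t] r0 by (cases "t = 0 \<or> t = 1") (auto simp: less_imp_le)
  have "AE t in lborel. t \<notin> {-1, 0, 1 :: real}"
    by (intro AE_not_in countable_imp_null_set_lborel) auto
  then have R0: "AE t in lborel. ?R t \<noteq> 0"
  proof eventually_elim
    case (elim t)
    then have "0 < \<bar>t\<bar>" "\<bar>t\<bar> \<noteq> 1" by auto
    then show ?case using pos[of "\<bar>t\<bar>"] by (smt (verit))
  qed
  have "0 \<le> sqrt (\<Sum>b\<in>Basis - {e}. (y \<bullet> b)\<^sup>2)" for y :: 'a by (simp add: sum_nonneg)
  then have "\<not> sqrt (\<Sum>b\<in>Basis - {e}. (y \<bullet> b)\<^sup>2) \<le> - 1" for y :: 'a
    by (meson less_le_trans not_less zero_less_one neg_less_0_iff_less)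
  then have "{y. \<bar>y \<bullet> e\<bar> \<le> 1 \<and> sqrt (\<Sum>b\<in>Basis - {e}. (y \<bullet> b)\<^sup>2) \<le> r \<bar>y \<bullet> e\<bar>} =
    {y. sqrt (\<Sum>b\<in>Basis - {e}. (y \<bullet> b)\<^sup>2) \<le> ?R (y \<bullet> e)}"
    by auto
  also have "emeasure lborel \<dots> = (\<integral>\<^sup>+t. ennreal (?v * max 0 (?R t) ^ d) \<partial>lborel)"
    by (subst emeasure_solid_of_revolution[OF e _ _ R0]) (use d in auto)
  also have "\<dots> = (\<integral>\<^sup>+t. ennreal (indicator {-1..1} t * (?v * \<bar>r \<bar>t\<bar>\<bar> ^ d)) \<partial>lborel)"
    using d r_nonneg by (intro nn_integral_cong) (auto simp: indicator_def max_def)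
  also have "\<dots> = ennreal (?v * (I + I))"
  proof (rule nn_integral_has_integral_lebesgue)
    have "((\<lambda>t. \<bar>r \<bar>t\<bar>\<bar> ^ d) has_integral I) {0..1}"
      by (rule has_integral_eq[OF _ I]) (use r_nonneg in auto)
    moreover from this have "((\<lambda>t. \<bar>r \<bar>t\<bar>\<bar> ^ d) has_integral I) {-1..0}"
      using has_integral_reflect_real[of "\<lambda>t. \<bar>r \<bar>t\<bar>\<bar> ^ d" I 1 0]
      by (simp only: minus_zero abs_minus_cancel)
    ultimately have "((\<lambda>t. \<bar>r \<bar>t\<bar>\<bar> ^ d) has_integral (I + I)) {-1..1}"
      by (intro has_integral_combine[of "-1" 0 1]) auto
    then show "((\<lambda>t. ?v * \<bar>r \<bar>t\<bar>\<bar> ^ d) has_integral ?v * (I + I)) {-1..1}"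
      by (rule has_integral_mult_right)
  qed simp
  finally show ?thesis by (simp add: algebra_simps)
qed

lemma norm_sq_component_rest:
  fixes y :: "'a :: euclidean_space"
  assumes "e \<in> Basis"
  shows "(norm y)\<^sup>2 = \<bar>y \<bullet> e\<bar>\<^sup>2 + (\<Sum>b\<in>Basis - {e}. (y \<bullet> b)\<^sup>2)"
proof -
  have "(norm y)\<^sup>2 = (\<Sum>b\<in>Basis. (y \<bullet> b)\<^sup>2)"
    unfolding power2_norm_eq_inner by (subst euclidean_inner) (simp add: power2_eq_square)
  then show ?thesis using sum.remove[of Basis e "\<lambda>b. (y \<bullet> b)\<^sup>2"] assms by simp
qed

text \<open>At height \<open>t\<close> the slice is bounded by the cone for \<open>t \<le> c\<close> and by the sphere for \<open>t \<ge> c\<close>.\<close>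
lemma emeasure_double_cap:
  fixes e :: "'a :: euclidean_space"
  assumes e: "e \<in> Basis" and d: "DIM('a) = Suc d" "0 < d" and c: "0 < c" "c < 1"
  shows "emeasure lborel {y \<in> cball 0 1. c * norm y \<le> \<bar>y \<bullet> e\<bar>} =
    ennreal (2 * unit_ball_vol (real d) * cap_profile d (1 - c\<^sup>2))"
proof -
  \<comment> \<open>The slope of the cone that meets the unit sphere at height \<open>c\<close>.\<close>
  define s where "s = sqrt (1 - c\<^sup>2) / c"
  have c2: "c\<^sup>2 < 1" using c by (simp add: power_less_one_iff abs_square_less_1)
  have s: "s > 0" "c * s = sqrt (1 - c\<^sup>2)" "s\<^sup>2 = (1 - c\<^sup>2) / c\<^sup>2"
    using c c2 by (auto simp: s_def power_divide)
  define r where "r = (\<lambda>t. min (sqrt (1 - t\<^sup>2)) (t * s))"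
  have "{y \<in> cball 0 1. c * norm y \<le> \<bar>y \<bullet> e\<bar>} =
    {y. \<bar>y \<bullet> e\<bar> \<le> 1 \<and> sqrt (\<Sum>b\<in>Basis - {e}. (y \<bullet> b)\<^sup>2) \<le> r \<bar>y \<bullet> e\<bar>}"
  proof (rule Collect_cong)
    fix y :: 'a
    define t where "t = \<bar>y \<bullet> e\<bar>"
    define Q where "Q = (\<Sum>b\<in>Basis - {e}. (y \<bullet> b)\<^sup>2)"
    have Q: "Q \<ge> 0" "t \<ge> 0" "(norm y)\<^sup>2 = t\<^sup>2 + Q"
      using norm_sq_component_rest[OF e, of y] by (auto simp: Q_def t_def sum_nonneg)
    have 1: "norm y \<le> 1 \<longleftrightarrow> Q \<le> 1 - t\<^sup>2"
      using abs_square_le_1[of "norm y"] Q by auto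
    have "c * norm y \<le> t \<longleftrightarrow> (c * norm y)\<^sup>2 \<le> t\<^sup>2"
      using c Q(2) by (intro power_mono_iff[symmetric]) auto
    also have "\<dots> \<longleftrightarrow> Q \<le> t\<^sup>2 * ((1 - c\<^sup>2) / c\<^sup>2)"
      using c by (simp add: power_mult_distrib Q(3) field_simps)
    also have "\<dots> \<longleftrightarrow> sqrt Q \<le> t * s"
      using real_sqrt_le_iff'[of Q "t * s"] Q s by (simp add: power_mult_distrib)
    finally have 2: "c * norm y \<le> t \<longleftrightarrow> sqrt Q \<le> t * s" .
    have 3: "t \<le> 1" if "Q \<le> 1 - t\<^sup>2"
      using that Q abs_square_le_1[of t] by auto
    show "y \<in> cball 0 1 \<and> c * norm y \<le> \<bar>y \<bullet> e\<bar> \<longleftrightarrow>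
        \<bar>y \<bullet> e\<bar> \<le> 1 \<and> sqrt (\<Sum>b\<in>Basis - {e}. (y \<bullet> b)\<^sup>2) \<le> r \<bar>y \<bullet> e\<bar>"
      unfolding t_def[symmetric] Q_def[symmetric] r_def using 1 2 3 by auto
  qed
  also have "emeasure lborel \<dots> = ennreal (2 * unit_ball_vol (real d) * cap_profile d (1 - c\<^sup>2))"
  proof (rule emeasure_symmetric_solid_of_revolution[OF e d])
    have "((\<lambda>t. r t ^ d) has_integral (s ^ d * (c ^ Suc d / (real d + 1)))) {0..c}"
    proof (rule has_integral_eq)
      have "((\<lambda>t. t ^ d) has_integral (c ^ Suc d / (real d + 1) - 0 ^ Suc d / (real d + 1))) {0..c}"
      proof (rule fundamental_theorem_of_calculus)
        fix t :: real
        have "((\<lambda>t. t ^ Suc d / (real d + 1)) has_real_derivative t ^ d) (at t within {0..c})"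
          using DERIV_cdivide[OF DERIV_pow[of "Suc d" t "{0..c}"], of "real d + 1"] by (simp add: add.commute)
        then show "((\<lambda>t. t ^ Suc d / (real d + 1)) has_vector_derivative t ^ d) (at t within {0..c})"
          by (simp only: has_real_derivative_iff_has_vector_derivative)
      qed (use c in simp)
      then show "((\<lambda>t. s ^ d * t ^ d) has_integral (s ^ d * (c ^ Suc d / (real d + 1)))) {0..c}"
        by (intro has_integral_mult_right) simp
      fix t assume t: "t \<in> {0..c}"
      then have "t\<^sup>2 \<le> c\<^sup>2" by (intro power_mono) auto
      then have "(t * s)\<^sup>2 \<le> 1 - t\<^sup>2"
        using c by (simp add: power_mult_distrib s(3) field_simps)
      then have "t * s \<le> sqrt (1 - t\<^sup>2)" by (rule real_le_rsqrt)
      then show "s ^ d * t ^ d = r t ^ d" by (simp add: r_def min_def power_mult_distrib)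
    qed
    moreover have "((\<lambda>t. r t ^ d) has_integral (integral {c..1} (\<lambda>t. sqrt (1 - t\<^sup>2) ^ d))) {c..1}"
    proof (rule has_integral_eq)
      show "((\<lambda>t. sqrt (1 - t\<^sup>2) ^ d) has_integral (integral {c..1} (\<lambda>t. sqrt (1 - t\<^sup>2) ^ d))) {c..1}"
        by (intro integrable_integral integrable_continuous_real continuous_on_sqrt_power)
      fix t assume t: "t \<in> {c..1}"
      then have "c\<^sup>2 \<le> t\<^sup>2" using c by (intro power_mono) auto
      then have "1 - t\<^sup>2 \<le> (t * s)\<^sup>2"
        using c by (simp add: power_mult_distrib s(3) field_simps)
      then have "sqrt (1 - t\<^sup>2) \<le> t * s" by (rule real_le_lsqrt[rotated]) (use t s c in auto)
      then show "sqrt (1 - t\<^sup>2) ^ d = r t ^ d" by (simp add: r_def min_def)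
    qed
    moreover have "cap_profile d (1 - c\<^sup>2) = s ^ d * (c ^ Suc d / (real d + 1)) + integral {c..1} (\<lambda>t. sqrt (1 - t\<^sup>2) ^ d)"
      using c by (simp add: cap_profile_def s(2)[symmetric] power_mult_distrib)
    ultimately show "((\<lambda>t. r t ^ d) has_integral cap_profile d (1 - c\<^sup>2)) {0..1}"
      using c has_integral_combine[of 0 c 1] by auto
    show "0 < r t" if "0 < t" "t < 1" for t
      using that s by (simp add: r_def abs_square_less_1)
  qed (use s in \<open>auto simp: r_def\<close>)
  finally show ?thesis .
qed

lemma emeasure_cball_cap_profile:
  assumes d: "DIM('a :: euclidean_space) = Suc d" "0 < d"
  shows "emeasure lborel (cball 0 1 :: 'a set) = ennreal (2 * unit_ball_vol (real d) * cap_profile d 1)"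
proof -
  obtain e :: 'a where e: "e \<in> Basis" using nonempty_Basis by blast
  have "cball 0 1 = {y. \<bar>y \<bullet> e\<bar> \<le> 1 \<and> sqrt (\<Sum>b\<in>Basis - {e}. (y \<bullet> b)\<^sup>2) \<le> sqrt (1 - \<bar>y \<bullet> e\<bar>\<^sup>2)}"
  proof (rule set_eqI)
    fix y :: 'a
    have Q: "0 \<le> (\<Sum>b\<in>Basis - {e}. (y \<bullet> b)\<^sup>2)" by (simp add: sum_nonneg)
    then show "y \<in> cball 0 1 \<longleftrightarrow> y \<in> {y. \<bar>y \<bullet> e\<bar> \<le> 1 \<and> sqrt (\<Sum>b\<in>Basis - {e}. (y \<bullet> b)\<^sup>2) \<le> sqrt (1 - \<bar>y \<bullet> e\<bar>\<^sup>2)}"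
      using abs_square_le_1[of "norm y"] norm_sq_component_rest[OF e, of y] abs_square_le_1[of "y \<bullet> e"]
      by (auto simp: real_sqrt_le_iff)
  qed
  also have "emeasure lborel \<dots> = ennreal (2 * unit_ball_vol (real d) * cap_profile d 1)"
    by (rule emeasure_symmetric_solid_of_revolution[OF e d])
       (auto simp: cap_profile_def d(2) abs_square_less_1
          intro!: integrable_integral integrable_continuous_real continuous_on_sqrt_power)
  finally show ?thesis .
qed

text \<open>Dividing by the volume of the ball, which is the same formula at \<open>x = 1\<close>, removes the constant
  \<open>unit_ball_vol d\<close>, so no value of the Gamma function enters.\<close>
lemma measure_double_cap:
  fixes e :: "'a :: euclidean_space"
  assumes e: "e \<in> Basis" and d: "DIM('a) = Suc d" "0 < d" and c: "0 < c" "c < 1"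
  shows "measure lborel {y \<in> cball 0 1. c * norm y \<le> \<bar>y \<bullet> e\<bar>} =
    reg_inc_beta (1 - c\<^sup>2) (real d / 2) (1 / 2) * measure lborel (cball 0 1 :: 'a set)"
proof -
  have c2: "c\<^sup>2 < 1" using c by (simp add: power_less_one_iff abs_square_less_1)
  have "0 < cap_profile d 1" "0 < cap_profile d (1 - c\<^sup>2)"
    using cap_profile_strict_mono[OF d(2), of 0] cap_profile_0[OF d(2)] c2 c by force+
  then show ?thesis
    unfolding measure_def emeasure_double_cap[OF assms] emeasure_cball_cap_profile[OF d]
    using reg_inc_beta_cap_profile[OF d(2), of "1 - c\<^sup>2"] c2 by simp
qed

section \<open>Lebesgue measure of linear images\<close>

lemma det_shear:
  fixes p q :: "'n :: finite"
  assumes "p \<noteq> q"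
  shows "det (matrix (\<lambda>x :: real^'n. \<chi> i. if i = p then x $ p + x $ q else x $ i)) = 1"
proof -
  have "matrix (\<lambda>x :: real^'n. \<chi> i. if i = p then x $ p + x $ q else x $ i) =
      (\<chi> k. if k = p then row p (mat 1) + 1 *s row q (mat 1) else row k (mat 1))"
    by (simp add: matrix_def vec_eq_iff row_def mat_def axis_def)
  then show ?thesis using det_row_operation[OF assms, of "mat 1 :: real^'n^'n" 1] by simp
qed

text \<open>Translating the box makes its lower bound in coordinate \<open>q\<close> zero, the case covered by
  \<open>measure_shear_interval\<close>; the shear turns the translation into another translation.\<close>
lemma measure_shear_cbox:
  fixes a b :: "real^'n"
  assumes "p \<noteq> q"
  shows "measure lebesgue ((\<lambda>x. \<chi> i. if i = p then x $ p + x $ q else x $ i) ` cbox a b) = measure lebesgue (cbox a b)"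
    (is "measure lebesgue (?h ` _) = _")
proof (cases "cbox a b = {}")
  case False
  define v :: "real^'n" where "v = (\<chi> i. if i = q then - a $ q else 0)"
  have hv: "?h x = - ?h v + ?h (v + x)" for x
    by (simp add: vec_eq_iff)
  have "?h ` cbox a b = (\<lambda>x. - ?h v + x) ` ?h ` (\<lambda>x. v + x) ` cbox a b"
    unfolding image_image by (rule image_cong[OF refl hv])
  then have "measure lebesgue (?h ` cbox a b) = measure lebesgue (?h ` (\<lambda>x. v + x) ` cbox a b)"
    by (simp only: measure_translation)
  also have "\<dots> = measure lebesgue (?h ` cbox (v + a) (v + b))" by (simp only: cbox_translation)
  also have "\<dots> = measure lebesgue (cbox (v + a) (v + b))"
    using False by (intro measure_shear_interval assms) (auto simp: cbox_translation v_def)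
  also have "\<dots> = measure lebesgue (cbox a b)"
    by (simp only: cbox_translation measure_translation)
  finally show ?thesis .
qed simp

text \<open>Elementary row operations generate all linear maps. The determinant of a shear comes from a row
  operation rather than from triangularity, so that the index type may be unordered.\<close>
lemma linear_image_lmeasurable_measure:
  fixes f :: "real^'n \<Rightarrow> real^'n"
  assumes "linear f" "S \<in> lmeasurable"
  shows "f ` S \<in> lmeasurable \<and> measure lebesgue (f ` S) = \<bar>det (matrix f)\<bar> * measure lebesgue S"
  using assms
proof (induction f arbitrary: S rule: induct_linear_elementary)
  case (2 f g)
  have g: "g ` S \<in> lmeasurable" "measure lebesgue (g ` S) = \<bar>det (matrix g)\<bar> * measure lebesgue S"
    using 2 by auto
  have fg: "f ` g ` S \<in> lmeasurable" "measure lebesgue (f ` g ` S) = \<bar>det (matrix f)\<bar> * measure lebesgue (g ` S)"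
    using 2 g(1) by auto
  show ?case
    unfolding image_comp[symmetric] matrix_compose[OF 2(2,1)] det_mul abs_mult
    using g fg by simp
next
  case (3 f i)
  have "f x \<noteq> axis i 1" for x using 3(2)[of x] by (metis axis_nth zero_neq_one)
  then have "\<not> surj f" by (metis surjD)
  then have inj: "\<not> inj f" using 3(1) linear_injective_imp_surjective by blast
  have "f ` S \<in> lmeasurable" "measure lebesgue (f ` S) = 0"
    using negligible_linear_singular_image[OF 3(1) inj, of S] negligible_iff_measure by blast+
  moreover have "det (matrix f) = 0" using det_nz_iff_inj[OF 3(1)] inj by blast
  ultimately show ?case by simp
next
  case (4 c)
  have "matrix (\<lambda>x :: real^'n. \<chi> i. c i * x $ i) = (\<chi> i j. if i = j then c i else 0)"
    by (simp add: matrix_def axis_def vec_eq_iff)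
  then have "det (matrix (\<lambda>x :: real^'n. \<chi> i. c i * x $ i)) = prod c UNIV"
    by (simp add: det_diagonal)
  then show ?case using measurable_stretch[OF 4(2)] measure_stretch[OF 4(2)] by simp
next
  case (5 p q)
  let ?t = "Transposition.transpose p q"
  let ?h = "\<lambda>x :: real^'n. \<chi> i. x $ ?t i"
  have lin: "linear ?h" by (rule linearI) (simp_all add: vec_eq_iff)
  have "matrix ?h = (\<chi> i. (mat 1 :: real^'n^'n) $ ?t i)"
    by (simp add: matrix_def vec_eq_iff mat_def axis_def)
  then have det: "\<bar>det (matrix ?h)\<bar> = 1"
    using det_permute_rows[of ?t "mat 1 :: real^'n^'n"] by (simp add: permutes_swap_id sign_swap_id)
  have "measure lebesgue (?h ` cbox a b) = 1 * measure lebesgue (cbox a b)" for a b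
  proof -
    have inv: "?h (?h x) = x" for x by (simp add: vec_eq_iff)
    have mem: "x \<in> cbox a b \<longleftrightarrow> ?h x \<in> cbox (?h a) (?h b)" for x
      unfolding mem_box_cart by (simp) (metis transpose_involutory)
    have img: "?h ` cbox a b = cbox (?h a) (?h b)"
    proof (intro subset_antisym subsetI)
      fix y assume "y \<in> ?h ` cbox a b"
      then obtain x where "x \<in> cbox a b" "y = ?h x" by blast
      then show "y \<in> cbox (?h a) (?h b)" using mem[of x] by (simp only:)
    next
      fix y assume "y \<in> cbox (?h a) (?h b)"
      then have "?h y \<in> cbox a b" using mem[of "?h y"] unfolding inv by (simp only:)
      then show "y \<in> ?h ` cbox a b" using imageI[of "?h y" "cbox a b" ?h] unfolding inv by (simp only:)
    qed
    have "(\<Prod>i\<in>UNIV. b $ ?t i - a $ ?t i) = (\<Prod>i\<in>UNIV. b $ i - a $ i)"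
      by (rule prod.reindex_bij_betw[OF bij_transpose, where g = "\<lambda>i. b $ i - a $ i"])
    moreover have "cbox (?h a) (?h b) = {} \<longleftrightarrow> cbox a b = {}"
      unfolding img[symmetric] by (rule image_is_empty)
    ultimately show ?thesis unfolding img by (simp add: content_cbox_if_cart)
  qed
  from measure_linear_sufficient[OF lin 5(3) this] show ?case by (simp only: det)
next
  case (6 p q)
  let ?h = "\<lambda>x :: real^'n. \<chi> i. if i = p then x $ p + x $ q else x $ i"
  have lin: "linear ?h" by (rule linearI) (auto simp: vec_eq_iff algebra_simps)
  from measure_linear_sufficient[OF lin 6(3), of 1] show ?case
    using measure_shear_cbox[OF 6(1)] det_shear[OF 6(1)] by auto
qed (use assms in auto)

section \<open>Directions in which a bound is violated\<close>

lemma space_uniform_sphere [simp]: "space uniform_sphere = (sphere 0 1 :: (real^'n) set)"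
  by (simp add: uniform_sphere_def space_restrict_space)

lemma sets_uniform_sphere [simp, measurable_cong]:
  "sets uniform_sphere = sets (restrict_space borel (sphere 0 1 :: (real^'n) set))"
  unfolding uniform_sphere_def by (rule sets_restrict_space_cong) simp

lemma emeasure_uniform_sphere:
  fixes C :: "(real^'n) set"
  assumes "C \<in> sets borel" "C \<subseteq> sphere 0 1"
  shows "emeasure uniform_sphere C = emeasure lborel (ball 0 1 \<inter> sgn -` C) / emeasure lborel (ball 0 1 :: (real^'n) set)"
proof -
  have sgn: "sgn -` C \<in> sets (borel :: (real^'n) measure)"
    using measurable_sets[OF borel_measurable_sgn assms(1)] by simp
  have "emeasure uniform_sphere C = emeasure (distr (uniform_measure lborel (ball 0 1)) borel sgn) C"
    unfolding uniform_sphere_def by (rule emeasure_restrict_space) (use assms in auto)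
  also have "\<dots> = emeasure (uniform_measure lborel (ball 0 1)) (sgn -` C)"
    by (subst emeasure_distr) (use assms in auto)
  also have "\<dots> = emeasure lborel (ball 0 1 \<inter> sgn -` C) / emeasure lborel (ball 0 1 :: (real^'n) set)"
    by (rule emeasure_uniform_measure) (use sgn in auto)
  finally show ?thesis .
qed

lemma emeasure_unit_ball_bounds:
  "0 < emeasure lborel (ball 0 1 :: (real^'n) set)" "emeasure lborel (ball 0 1 :: (real^'n) set) < \<infinity>"
  using emeasure_lborel_ball_finite[of "0::real^'n" 1] by (auto simp: emeasure_ball)

lemma prob_space_uniform_sphere: "prob_space (uniform_sphere :: (real^'n) measure)"
proof
  have "emeasure lborel (ball 0 1 \<inter> sgn -` sphere 0 1 :: (real^'n) set) = emeasure lborel (ball 0 1 :: (real^'n) set)"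
  proof (rule emeasure_eq_AE)
    have "AE x in lborel. x \<notin> {0 :: real^'n}"
      by (intro AE_not_in countable_imp_null_set_lborel) auto
    then show "AE x::real^'n in lborel. x \<in> ball 0 1 \<inter> sgn -` sphere 0 1 \<longleftrightarrow> x \<in> ball 0 1"
      by eventually_elim (auto simp: norm_sgn)
    have "sgn -` sphere 0 1 \<in> sets (borel :: (real^'n) measure)"
      using measurable_sets[OF borel_measurable_sgn, of "sphere (0::real^'n) 1"]
        borel_closed[OF closed_sphere, of "0::real^'n" 1] by simp
    then show "ball 0 1 \<inter> sgn -` sphere 0 1 \<in> sets (lborel :: (real^'n) measure)" by simp
  qed simp
  then show "emeasure uniform_sphere (space uniform_sphere :: (real^'n) set) = 1"
    using emeasure_uniform_sphere[of "sphere 0 1 :: (real^'n) set"] emeasure_unit_ball_bounds[where 'n = 'n]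
    by (simp add: ennreal_divide_self)
qed

text \<open>The measure of a set of directions is the share of the unit ball that its cone fills. All estimates
  on the sphere are made for these cones, where Lebesgue measure and linear maps are available.\<close>
lemma measure_uniform_sphere:
  fixes C :: "(real^'n) set"
  assumes "C \<in> sets borel" "C \<subseteq> sphere 0 1"
  shows "measure uniform_sphere C * measure lborel (ball 0 1 :: (real^'n) set) = measure lborel (ball 0 1 \<inter> sgn -` C)"
proof -
  let ?b = "emeasure lborel (ball 0 1 :: (real^'n) set)"
  have "emeasure uniform_sphere C * ?b = emeasure lborel (ball 0 1 \<inter> sgn -` C)"
    using emeasure_unit_ball_bounds[where 'n = 'n]
    by (simp add: emeasure_uniform_sphere[OF assms] mult.commute[of "_ / _"] ennreal_times_divide)
       (simp add: mult.commute[of ?b] mult_divide_eq_ennreal)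
  then show ?thesis by (simp add: measure_def enn2real_mult[symmetric])
qed


text \<open>This is where \<open>kappa\<close> comes from. With \<open>l = sqrt (lambda_min P)\<close>, the map \<open>l M Q\<close> sends the unit ball into
  itself, because \<open>M Q y\<close> has \<open>P\<close>-norm equal to \<open>norm y\<close> and the \<open>P\<close>-norm is at least \<open>l\<close> times the Euclidean
  norm. It carries the nonzero points of \<open>S\<close> into the cone over \<open>C\<close> and multiplies volume by
  \<open>l\<^sup>n / \<bar>det R\<bar> = 1 / kappa P\<close>.\<close>
lemma measure_ellipsoidal_image_ge:
  fixes R M :: "real^'n^'n" and Q :: "real^'n \<Rightarrow> real^'n"
  assumes RR: "R ** M = mat 1" and P: "P = transpose R ** R" and feas: "quad_feasible \<delta> P"
    and Q: "orthogonal_transformation Q" and S: "S \<in> sets borel" "S \<subseteq> ball 0 1"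
    and C: "C \<in> sets borel" "C \<subseteq> sphere 0 1"
    and SC: "\<And>y. y \<in> S \<Longrightarrow> y \<noteq> 0 \<Longrightarrow> sgn (M *v Q y) \<in> C"
  shows "measure lborel S \<le> kappa P * measure uniform_sphere C * measure lborel (ball 0 1 :: (real^'n) set)"
proof -
  define l where "l = sqrt (lambda_min P)"
  have l: "l > 0" "l\<^sup>2 = lambda_min P" using lambda_min_ge_1[OF feas] by (auto simp: l_def)
  define g where "g = (\<lambda>y. (l *\<^sub>R M) *v Q y)"
  have g_eq: "g y = l *\<^sub>R (M *v Q y)" for y
    by (simp add: g_def scaleR_matrix_vector_assoc[symmetric])
  have linQ: "linear Q" using Q by (rule orthogonal_transformation_linear)
  have g_comp: "g = (*v) (l *\<^sub>R M) \<circ> Q" by (auto simp: g_def)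
  have lin: "linear g" unfolding g_comp by (intro linear_compose linQ matrix_vector_mul_linear)
  have detR: "det R * det M = 1" using RR by (metis det_I det_mul)
  have detP: "det P = (det R)\<^sup>2" by (simp add: P det_mul power2_eq_square)
  have "det (matrix g) = det (l *\<^sub>R M) * det (matrix Q)"
    unfolding g_comp by (simp add: matrix_compose[OF linQ] det_mul)
  moreover have "det (l *\<^sub>R M) = l ^ CARD('n) * det M"
  proof -
    have "l *\<^sub>R M = matrix ((*\<^sub>R) l) ** M"
      by (simp add: matrix_eq matrix_vector_mul_assoc[symmetric] scaleR_matrix_vector_assoc[symmetric] matrix_works linear_scale_self)
    then show ?thesis by (simp add: det_mul)
  qed
  moreover have "\<bar>det (matrix Q)\<bar> = 1" using Q orthogonal_transformation_det by blast
  ultimately have "\<bar>det (matrix g)\<bar> = l ^ CARD('n) * \<bar>det M\<bar>" using l by (simp add: abs_mult)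
  moreover have "kappa P = \<bar>det R\<bar> / l ^ CARD('n)"
  proof -
    have "kappa P = sqrt ((det R / l ^ CARD('n))\<^sup>2)"
      unfolding kappa_def detP l(2)[symmetric] by (simp add: power_divide power_mult[symmetric] mult.commute)
    then show ?thesis using l by simp
  qed
  ultimately have k: "kappa P * \<bar>det (matrix g)\<bar> = 1"
    using detR l by (simp add: abs_mult[symmetric])
  have kpos: "0 \<le> kappa P" using \<open>kappa P = _\<close> l by simp
  let ?K = "ball 0 1 \<inter> sgn -` C"
  have K: "?K \<in> sets borel"
    using measurable_sets[OF borel_measurable_sgn C(1)] by simp
  have lmeas: "X \<in> lmeasurable" if "X \<in> sets borel" "X \<subseteq> ball 0 1" for X :: "(real^'n) set"
    using that bounded_subset[OF bounded_ball that(2)] by (intro bounded_set_imp_lmeasurable) auto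
  have sub: "g ` (S - {0}) \<subseteq> ?K"
  proof (rule image_subsetI)
    fix y assume "y \<in> S - {0}"
    then have y: "y \<in> S" "y \<noteq> 0" by auto
    have "R *v (M *v Q y) = Q y"
      by (simp add: matrix_vector_mul_assoc RR)
    then have "quad_norm P (M *v Q y) = norm (Q y)"
      by (simp only: P quad_norm_gram)
    then have "norm (g y) \<le> norm (Q y)"
      using quad_norm_lambda_bounds(1)[OF feas, of "M *v Q y"] l by (simp add: g_eq l_def)
    also have "\<dots> < 1" using y S(2) Q by (auto simp: orthogonal_transformation_norm)
    finally have "g y \<in> ball 0 1" by simp
    moreover have "sgn (g y) \<in> C" using SC[OF y] l by (simp add: g_eq sgn_scaleR)
    ultimately show "g y \<in> ?K" by simp
  qed
  have S0: "S - {0} \<in> lmeasurable" using S by (intro lmeas) auto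
  note image = linear_image_lmeasurable_measure[OF lin S0]
  have "measure lborel S = measure lebesgue (S - {0})"
    using S measure_Diff_null_set[of S lborel "{0}"]
      countable_imp_null_set_lborel[of "{0 :: real^'n}"] by (simp add: measure_completion)
  also have "\<dots> = kappa P * measure lebesgue (g ` (S - {0}))"
    using k by (simp add: image mult.assoc[symmetric])
  also have "\<dots> \<le> kappa P * measure lebesgue ?K"
    by (intro mult_left_mono kpos measure_mono_fmeasurable[OF sub fmeasurableD[OF conjunct1[OF image]] lmeas[OF K]]) simp
  also have "measure lebesgue ?K = measure lborel ?K" using K by (simp add: measure_completion)
  also have "\<dots> = measure uniform_sphere C * measure lborel (ball 0 1 :: (real^'n) set)"
    by (rule measure_uniform_sphere[OF C, symmetric])
  finally show ?thesis by (simp add: mult.assoc)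
qed


lemma quad_norm_scaleR: "quad_norm P (c *\<^sub>R x) = \<bar>c\<bar> * quad_norm P x"
  by (simp add: quad_norm_def matrix_vector_mult_scaleR real_sqrt_mult[symmetric] real_sqrt_abs
      power2_eq_square mult.assoc[symmetric] real_sqrt_mult)

lemma borel_measurable_quad_norm [measurable]: "(\<lambda>x. quad_norm P (A *v x)) \<in> borel_measurable borel"
  unfolding quad_norm_def matrix_vector_mul_assoc
  by (intro borel_measurable_continuous_onI continuous_intros matrix_vector_mult_linear_continuous_on)

text \<open>In the coordinates \<open>R\<close>, whose inverse is \<open>M\<close>, the map \<open>A\<close> becomes \<open>B = R A M\<close>, and one vector \<open>y0\<close> that \<open>B\<close>
  stretches by at least \<open>r\<close> yields a whole double cap of directions that it stretches by more than \<open>L\<close>. Let \<open>u\<close>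
  be the unit vector in the direction of \<open>B y0\<close> and \<open>w = B\<^sup>T u\<close>. Then \<open>norm w \<ge> r\<close> because
  \<open>w \<bullet> y0 = norm (B y0)\<close>, and \<open>norm (B y) \<ge> \<bar>w \<bullet> y\<bar>\<close> for all \<open>y\<close>. So every \<open>y\<close> whose height over \<open>w\<close> is at least
  \<open>c * norm y\<close> is stretched by at least \<open>c * r > L\<close>.\<close>
lemma violating_directions_ge:
  fixes P A :: "real^'n^'n"
  assumes d: "CARD('n) = Suc d" "0 < d" and feas: "quad_feasible \<delta> P"
    and c: "0 < c" "c < 1" and x0: "x0 \<noteq> 0" and r: "0 < r" "r * quad_norm P x0 \<le> quad_norm P (A *v x0)"
    and lr: "L < c * r"
  shows "reg_inc_beta (1 - c\<^sup>2) (real d / 2) (1 / 2) \<le>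
    kappa P * measure uniform_sphere {x \<in> sphere 0 1. L * quad_norm P x < quad_norm P (A *v x)}"
proof -
  obtain R M :: "real^'n^'n" where RM: "R ** M = mat 1" "M ** R = mat 1" and P: "P = transpose R ** R"
    using pos_def_gram_factorization[OF quad_feasible_bounds(1,4)[OF feas]] by blast
  have qn: "quad_norm P x = norm (R *v x)" for x by (simp only: P quad_norm_gram)
  define B where "B = R ** A ** M"
  have Rinv: "R *v (M *v y) = y" "M *v (R *v y) = y" for y
    by (simp_all add: matrix_vector_mul_assoc RM)
  have BR: "B *v y = R *v (A *v (M *v y))" for y
    by (simp add: B_def matrix_vector_mul_assoc matrix_mul_assoc)
  define y0 where "y0 = R *v x0"
  have By0: "norm (B *v y0) = quad_norm P (A *v x0)" by (simp add: BR y0_def Rinv qn)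
  have y0: "norm y0 = quad_norm P x0" "norm y0 > 0"
    using x0 Rinv(2)[of x0] by (auto simp: y0_def qn)
  define u where "u = sgn (B *v y0)"
  define w where "w = u v* B"
  have "r * norm y0 \<le> norm (B *v y0)" using r(2) by (simp add: By0 y0)
  moreover have "r * norm y0 > 0" using r(1) y0 by simp
  ultimately have By0_pos: "norm (B *v y0) > 0" by linarith
  have u: "norm u = 1" using By0_pos by (simp add: u_def norm_sgn)
  have w_inner: "w \<bullet> y = u \<bullet> (B *v y)" for y by (simp add: w_def dot_lmul_matrix)
  have "w \<bullet> y0 = norm (B *v y0)"
    using By0_pos by (simp add: w_inner u_def sgn_div_norm power2_norm_eq_inner[symmetric] power2_eq_square)
  then have "r * norm y0 \<le> norm w * norm y0"
    using \<open>r * norm y0 \<le> _\<close> norm_cauchy_schwarz[of w y0] by simp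
  then have w: "r \<le> norm w" using y0 by simp
  then have w0: "w \<noteq> 0" using r by auto
  \<comment> \<open>Any coordinate axis serves; the rotation \<open>Q\<close> below takes it to the direction of \<open>w\<close>.\<close>
  define e :: "real^'n" where "e = axis undefined 1"
  have e: "e \<in> Basis" by (auto simp: e_def axis_in_Basis_iff)
  obtain Q where Q: "orthogonal_transformation Q" "Q e = sgn w"
    using orthogonal_transformation_exists_1[of e "sgn w"] e w0 by (auto simp: norm_sgn)
  define C where "C = {x \<in> sphere 0 1. L * quad_norm P x < quad_norm P (A *v x)}"
  have C: "C \<in> sets borel" "C \<subseteq> sphere 0 1"
  proof -
    have [measurable]: "(\<lambda>x. quad_norm P x) \<in> borel_measurable borel"
      using borel_measurable_quad_norm[of P "mat 1"] by simp
    have "{x \<in> space borel. norm x = 1 \<and> L * quad_norm P x < quad_norm P (A *v x)} \<in> sets borel"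
      by measurable
    then show "C \<in> sets borel" by (simp add: C_def)
  qed (auto simp: C_def)
  define S where "S = {y \<in> cball 0 1. c * norm y \<le> \<bar>y \<bullet> e\<bar>} \<inter> ball 0 1"
  have cap: "{y \<in> cball 0 1. c * norm y \<le> \<bar>y \<bullet> e\<bar>} \<in> sets borel"
  proof -
    have "{y \<in> space borel. norm y \<le> 1 \<and> c * norm y \<le> \<bar>y \<bullet> e\<bar>} \<in> sets borel" by measurable
    then show ?thesis by simp
  qed
  have SC: "sgn (M *v Q y) \<in> C" if y: "y \<in> S" "y \<noteq> 0" for y
  proof -
    define z where "z = M *v Q y"
    have Rz: "R *v z = Q y" by (simp add: z_def Rinv)
    have nz: "quad_norm P z = norm y" using Q by (simp add: qn Rz orthogonal_transformation_norm)
    then have z0: "z \<noteq> 0" using y by (auto simp: quad_norm_def)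
    have "L * norm y < c * r * norm y" using lr y by simp
    also have "\<dots> \<le> c * norm w * norm y" using w c by (simp add: mult_right_mono)
    also have "\<dots> = norm w * (c * norm y)" by simp
    also have "\<dots> \<le> norm w * \<bar>y \<bullet> e\<bar>" using y by (intro mult_left_mono) (auto simp: S_def)
    also have "\<dots> = \<bar>w \<bullet> Q y\<bar>"
    proof -
      have "y \<bullet> e = Q y \<bullet> sgn w" using Q by (metis orthogonal_transformation_def)
      then show ?thesis using w0 by (simp add: sgn_div_norm inner_commute abs_mult)
    qed
    also have "\<dots> \<le> norm (B *v Q y)"
      using Cauchy_Schwarz_ineq2[of u "B *v Q y"] u by (simp add: w_inner)
    also have "\<dots> = quad_norm P (A *v z)" by (simp add: BR z_def qn)
    finally have "L * quad_norm P z < quad_norm P (A *v z)" by (simp add: nz)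
    then have "L * quad_norm P (sgn z) < quad_norm P (A *v sgn z)"
      using z0 by (simp add: sgn_div_norm matrix_vector_mult_scaleR quad_norm_scaleR)
    then show ?thesis using z0 by (simp add: C_def norm_sgn z_def[symmetric])
  qed
  have null: "sphere 0 1 \<in> null_sets (lborel :: (real^'n) measure)"
    using negligible_sphere[of "0::real^'n" 1] borel_closed[OF closed_sphere, of "0::real^'n" 1]
    by (simp add: negligible_iff_null_sets null_sets_completion_iff)
  have diff: "measure lborel (X - sphere 0 1) = measure lborel X" if "X \<in> sets borel" for X :: "(real^'n) set"
    using measure_Diff_null_set[OF _ null, of X] that by simp
  have ball: "ball 0 1 = cball 0 1 - sphere (0::real^'n) 1" by auto
  have bpos: "measure lborel (ball 0 1 :: (real^'n) set) > 0"
    using content_ball_pos[of 1 "0::real^'n"] by simp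
  have "reg_inc_beta (1 - c\<^sup>2) (real d / 2) (1 / 2) * measure lborel (ball 0 1 :: (real^'n) set) =
      measure lborel {y \<in> cball 0 1. c * norm y \<le> \<bar>y \<bullet> e\<bar>}"
    unfolding ball using measure_double_cap[OF e _ d(2) c] d(1) diff[of "cball 0 1"] by simp
  also have "\<dots> = measure lborel S"
  proof -
    have "S = {y \<in> cball 0 1. c * norm y \<le> \<bar>y \<bullet> e\<bar>} - sphere 0 1" by (auto simp: S_def)
    then show ?thesis using diff[OF cap] by simp
  qed
  also have "\<dots> \<le> kappa P * measure uniform_sphere C * measure lborel (ball 0 1 :: (real^'n) set)"
    by (rule measure_ellipsoidal_image_ge[OF RM(1) P feas Q(1) _ _ C SC]) (use cap in \<open>auto simp: S_def\<close>)
  finally show ?thesis using bpos by (simp add: C_def)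
qed

text \<open>A bound that fails only on a small set of directions holds everywhere once it is divided by
  \<open>zeta\<close>: a failure of the relaxed bound would produce a double cap of failures of the original bound
  that is too large.\<close>
lemma quad_norm_le_of_rare_violations:
  fixes P A :: "real^'n^'n"
  assumes n: "2 \<le> CARD('n)" and feas: "quad_feasible \<delta> P" and l: "0 < L" and y: "0 \<le> y" "y < 1 / 2"
    and rare: "kappa P * measure uniform_sphere {x \<in> sphere 0 1. L * quad_norm P x < quad_norm P (A *v x)} \<le> 2 * y"
  shows "quad_norm P (A *v x) \<le> L / zeta CARD('n) y * quad_norm P x"
proof (rule ccontr)
  assume not_le: "\<not> ?thesis"
  obtain d where d: "CARD('n) = Suc d" "0 < d" using n by (cases "CARD('n)") auto
  define z where "z = zeta CARD('n) y"
  have z: "0 < z" "z \<le> 1" using zeta_cap_height(1,2)[OF d(2) y] by (auto simp: z_def d(1))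
  have x: "x \<noteq> 0" using not_le by (auto simp: quad_norm_def)
  have qx: "0 < quad_norm P x" using quad_norm_bounds(1)[OF feas, of x] x by (meson less_le_trans zero_less_norm_iff)
  define r where "r = quad_norm P (A *v x) / quad_norm P x"
  have r: "L / z < r" using not_le qx by (simp add: r_def z_def field_simps not_le)
  have rpos: "0 < r" using r l z by (meson divide_pos_pos less_trans)
  \<comment> \<open>Since \<open>r\<close> exceeds \<open>L / z\<close> strictly, there is room for a height \<open>c\<close> with \<open>L < c r\<close> and \<open>c < z\<close>.\<close>
  have "L / r < z" using r rpos z by (simp add: field_simps)
  then obtain c where c: "L / r < c" "c < z" using dense by blast
  have c0: "0 < c" using c(1) l rpos by (meson divide_pos_pos less_trans)
  have "reg_inc_beta (1 - c\<^sup>2) (real d / 2) (1 / 2) \<le> 2 * y"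
    using violating_directions_ge[OF d feas c0 _ x rpos, of A L] c z rpos qx rare
    by (auto simp: r_def field_simps)
  moreover have "2 * y < reg_inc_beta (1 - c\<^sup>2) (real d / 2) (1 / 2)"
    using zeta_cap_height(3)[OF d(2) y, of c] c c0 by (simp add: z_def d(1))
  ultimately show False by simp
qed

section \<open>Binomial tails and the Clopper-Pearson limit\<close>

definition binomial_cdf :: "nat \<Rightarrow> nat \<Rightarrow> real \<Rightarrow> real" where
  "binomial_cdf n F q = (\<Sum>l=0..F. real (n choose l) * q ^ l * (1 - q) ^ (n - l))"

text \<open>The derivative of the sum telescopes to a single term, which shows strict monotonicity.\<close>
lemma DERIV_binomial_cdf:
  assumes "F < n"
  shows "(binomial_cdf n F has_real_derivative
    - (real (n choose F) * real (n - F) * q ^ F * (1 - q) ^ (n - Suc F))) (at q)"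
  using assms
proof (induction F)
  case 0
  have "binomial_cdf n 0 = (\<lambda>q. (1 - q) ^ n)" by (auto simp: binomial_cdf_def)
  then show ?case by (auto intro!: derivative_eq_intros)
next
  case (Suc F)
  let ?k = "Suc F"
  have eq: "binomial_cdf n ?k = (\<lambda>q. binomial_cdf n F q + real (n choose ?k) * q ^ ?k * (1 - q) ^ (n - ?k))"
    by (auto simp: binomial_cdf_def)
  have ch: "real (n choose ?k) * real ?k = real (n choose F) * real (n - F)"
    by (metis binomial_absorb_comp mult.commute of_nat_mult binomial_absorption)
  have IH: "(binomial_cdf n F has_real_derivative - (real (n choose F) * real (n - F) * q ^ F * (1 - q) ^ (n - ?k))) (at q)"
    using Suc by simp
  have d1: "((\<lambda>q. q ^ ?k) has_real_derivative real ?k * q ^ F) (at q)"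
    using DERIV_pow[of ?k q UNIV] by simp
  have d2: "((\<lambda>q. (1 - q) ^ (n - ?k)) has_real_derivative - (real (n - ?k) * (1 - q) ^ (n - Suc ?k))) (at q)"
    by (auto intro!: derivative_eq_intros)
  have "real (n choose ?k) * (real ?k * q ^ F) * (1 - q) ^ (n - ?k) =
      real (n choose F) * real (n - F) * q ^ F * (1 - q) ^ (n - ?k)"
    by (simp only: mult.assoc[symmetric] ch)
  then show ?case
    unfolding eq
    by (intro DERIV_cong[OF DERIV_add[OF IH DERIV_mult[OF DERIV_cmult[OF d1, of "real (n choose ?k)"] d2]]])
       (simp del: of_nat_Suc add: mult_ac)
qed

lemma continuous_on_binomial_cdf: "continuous_on S (binomial_cdf n F)"
  unfolding binomial_cdf_def by (intro continuous_intros)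

lemma binomial_cdf_strict_antimono:
  assumes "F < n" "0 \<le> p" "p < q" "q \<le> 1"
  shows "binomial_cdf n F q < binomial_cdf n F p"
proof (rule DERIV_neg_imp_decreasing_open[where f = "binomial_cdf n F" and a = p and b = q])
  show "\<exists>D. (binomial_cdf n F has_real_derivative D) (at x) \<and> D < 0" if "p < x" "x < q" for x
  proof -
    have "0 < real (n choose F) * real (n - F) * x ^ F * (1 - x) ^ (n - Suc F)"
      using that assms by (intro mult_pos_pos) auto
    then have "- (real (n choose F) * real (n - F) * x ^ F * (1 - x) ^ (n - Suc F)) < 0" by (simp only: neg_less_0_iff_less)
    then show ?thesis using DERIV_binomial_cdf[OF assms(1), of x] by blast
  qed
  show "continuous_on {p..q} (binomial_cdf n F)"
    by (rule continuous_on_binomial_cdf)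
qed fact

text \<open>Monotonicity makes the solution that \<open>q_hat\<close> refers to unique, so the description operator denotes it.\<close>
lemma binomial_cdf_q_hat:
  assumes "F < n" "0 < \<beta>" "\<beta> < 1"
  shows "q_hat n \<beta> F \<in> {0..1}" "binomial_cdf n F (q_hat n \<beta> F) = \<beta>"
proof -
  have c: "continuous_on {0..1} (binomial_cdf n F)"
    by (rule continuous_on_binomial_cdf)
  have 0: "binomial_cdf n F 0 = 1"
    by (simp add: binomial_cdf_def sum.atLeast_Suc_atMost power_0_left)
  have 1: "binomial_cdf n F 1 = 0"
    using assms(1) by (auto simp: binomial_cdf_def power_0_left)
  obtain q where q: "q \<in> {0..1}" "binomial_cdf n F q = \<beta>"
    using IVT2'[of "binomial_cdf n F" 1 \<beta> 0] c 0 1 assms by auto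
  have "q_hat n \<beta> F = (THE q. q \<in> {0..1} \<and> binomial_cdf n F q = \<beta>)"
    using assms(1) by (simp add: q_hat_def binomial_cdf_def)
  also have "\<dots> = q"
  proof (rule the_equality)
    fix q' assume q': "q' \<in> {0..1} \<and> binomial_cdf n F q' = \<beta>"
    then show "q' = q"
      using binomial_cdf_strict_antimono[OF assms(1), of q q'] binomial_cdf_strict_antimono[OF assms(1), of q' q] q
      by (cases q q' rule: linorder_cases) auto
  qed (use q in auto)
  finally show "q_hat n \<beta> F \<in> {0..1}" "binomial_cdf n F (q_hat n \<beta> F) = \<beta>" using q by auto
qed

lemma binomial_cdf_less_if_q_hat_less:
  assumes "F \<le> n" "0 < \<beta>" "\<beta> < 1" "V \<le> 1" "q_hat n \<beta> F < V"
  shows "F < n" "binomial_cdf n F V < \<beta>"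
proof -
  show F: "F < n" using assms by (cases "F = n") (auto simp: q_hat_def)
  show "binomial_cdf n F V < \<beta>"
    using binomial_cdf_strict_antimono[OF F _ assms(5)] binomial_cdf_q_hat[OF F assms(2,3)] assms(4) by auto
qed

text \<open>The event that the hits are exactly the indices in \<open>S\<close> is a box, so its probability is a product; there
  are \<open>card T choose l\<close> sets \<open>S\<close> of size \<open>l\<close>.\<close>
lemma (in prob_space) prob_card_hits_le:
  assumes T: "finite T" and B[measurable]: "B \<in> events"
  shows "{\<omega> \<in> space (Pi\<^sub>M T (\<lambda>_. M)). card {i \<in> T. \<omega> i \<in> B} \<le> F} \<in> sets (Pi\<^sub>M T (\<lambda>_. M))" (is "?E \<in> _")
    and "measure (Pi\<^sub>M T (\<lambda>_. M)) {\<omega> \<in> space (Pi\<^sub>M T (\<lambda>_. M)). card {i \<in> T. \<omega> i \<in> B} \<le> F} =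
      binomial_cdf (card T) F (prob B)"
proof -
  interpret P: finite_product_prob_space "\<lambda>_. M" T
    by standard (use T in auto)
  define box where "box S = Pi\<^sub>E T (\<lambda>i. if i \<in> S then B else space M - B)" for S
  have Bs: "B \<subseteq> space M" using B by (rule sets.sets_into_space)
  have box: "\<omega> \<in> box S \<longleftrightarrow> \<omega> \<in> space (Pi\<^sub>M T (\<lambda>_. M)) \<and> {i \<in> T. \<omega> i \<in> B} = S" if "S \<subseteq> T" for S \<omega>
  proof -
    have "\<omega> \<in> box S \<longleftrightarrow> (\<forall>i\<in>T. \<omega> i \<in> space M \<and> (\<omega> i \<in> B \<longleftrightarrow> i \<in> S)) \<and> \<omega> \<in> extensional T"
      unfolding box_def PiE_iff by (intro conj_cong ball_cong refl) (use Bs in auto)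
    also have "\<dots> \<longleftrightarrow> \<omega> \<in> space (Pi\<^sub>M T (\<lambda>_. M)) \<and> (\<forall>i\<in>T. \<omega> i \<in> B \<longleftrightarrow> i \<in> S)"
      unfolding space_PiM PiE_iff by blast
    also have "(\<forall>i\<in>T. \<omega> i \<in> B \<longleftrightarrow> i \<in> S) \<longleftrightarrow> {i \<in> T. \<omega> i \<in> B} = S"
      using that by blast
    finally show ?thesis .
  qed
  have box_sets: "box S \<in> sets (Pi\<^sub>M T (\<lambda>_. M))" for S
    unfolding box_def using T by (intro sets_PiM_I_finite) auto
  let ?I = "\<lambda>l. {S. S \<subseteq> T \<and> card S = l}"
  let ?J = "{S. S \<subseteq> T \<and> card S \<le> F}"
  have fin: "finite ?J" using T by simp
  have E: "?E = (\<Union>S\<in>?J. box S)"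
  proof (intro set_eqI iffI)
    fix \<omega> assume "\<omega> \<in> ?E"
    then show "\<omega> \<in> (\<Union>S\<in>?J. box S)"
      using box[of "{i \<in> T. \<omega> i \<in> B}" \<omega>] by (intro UN_I[of "{i \<in> T. \<omega> i \<in> B}"]) auto
  next
    fix \<omega> assume "\<omega> \<in> (\<Union>S\<in>?J. box S)"
    then show "\<omega> \<in> ?E" using box by auto
  qed
  show "?E \<in> sets (Pi\<^sub>M T (\<lambda>_. M))"
    unfolding E by (intro sets.finite_UN fin box_sets)
  have prob_box: "P.prob (box S) = prob B ^ card S * (1 - prob B) ^ (card T - card S)" if "S \<subseteq> T" for S
  proof -
    have "P.prob (box S) = (\<Prod>i\<in>T. prob (if i \<in> S then B else space M - B))"
      unfolding box_def by (rule P.prob_times) simp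
    also have "\<dots> = (\<Prod>i\<in>T. if i \<in> S then prob B else 1 - prob B)"
      by (intro prod.cong) (auto simp: prob_compl)
    also have "\<dots> = prob B ^ card S * (1 - prob B) ^ card (T - S)"
      using T that by (simp add: prod.If_cases Int_absorb1 Diff_eq)
    also have "card (T - S) = card T - card S" using T that by (simp add: card_Diff_subset finite_subset)
    finally show ?thesis .
  qed
  have "P.prob ?E = (\<Sum>S\<in>?J. P.prob (box S))"
    unfolding E
  proof (rule P.finite_measure_finite_Union[OF fin])
    show "disjoint_family_on box ?J"
    proof (unfold disjoint_family_on_def, intro ballI impI)
      fix S S' assume "S \<in> ?J" "S' \<in> ?J" "S \<noteq> S'"
      then have "\<omega> \<notin> box S \<inter> box S'" for \<omega> using box[of S \<omega>] box[of S' \<omega>] by auto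
      then show "box S \<inter> box S' = {}" by blast
    qed
  qed (use box_sets in auto)
  also have "\<dots> = (\<Sum>S\<in>?J. prob B ^ card S * (1 - prob B) ^ (card T - card S))"
    by (intro sum.cong prob_box) auto
  also have "?J = (\<Union>l\<in>{0..F}. ?I l)" by auto
  also have "(\<Sum>S\<in>(\<Union>l\<in>{0..F}. ?I l). prob B ^ card S * (1 - prob B) ^ (card T - card S)) =
      (\<Sum>l=0..F. \<Sum>S\<in>?I l. prob B ^ card S * (1 - prob B) ^ (card T - card S))"
    using T by (intro sum.UNION_disjoint) auto
  also have "\<dots> = (\<Sum>l=0..F. \<Sum>S\<in>?I l. prob B ^ l * (1 - prob B) ^ (card T - l))"
    by (intro sum.cong) auto
  also have "\<dots> = binomial_cdf (card T) F (prob B)"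
    using n_subsets[OF T] by (simp add: binomial_cdf_def mult.assoc)
  finally show "P.prob ?E = binomial_cdf (card T) F (prob B)" .
qed

text \<open>The upper limit \<open>q_hat\<close> misses the true probability \<open>V = prob B\<close> only if the number \<open>F\<close> of hits is so small
  that the binomial distribution with parameter \<open>V\<close> has mass below \<open>\<beta>\<close> up to \<open>F\<close>. If \<open>F\<close> is at most the largest number with
  this property, an event of probability less than \<open>\<beta>\<close> has occurred.\<close>
lemma (in prob_space) clopper_pearson:
  assumes T: "finite T" and B: "B \<in> events" and \<beta>: "0 < \<beta>" "\<beta> < 1"
  obtains E where "E \<in> sets (Pi\<^sub>M T (\<lambda>_. M))" "emeasure (Pi\<^sub>M T (\<lambda>_. M)) E \<le> ennreal \<beta>"
    "\<And>\<omega>. \<omega> \<in> space (Pi\<^sub>M T (\<lambda>_. M)) \<Longrightarrow> q_hat (card T) \<beta> (card {i \<in> T. \<omega> i \<in> B}) < prob B \<Longrightarrow> \<omega> \<in> E"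
proof -
  interpret P: finite_product_prob_space "\<lambda>_. M" T
    by standard (use T in auto)
  \<comment> \<open>The numbers of hits for which \<open>q_hat\<close> is too small; the value \<open>F = card T\<close> is harmless, as then \<open>q_hat = 1\<close>.\<close>
  define G where "G = {F. F < card T \<and> binomial_cdf (card T) F (prob B) < \<beta>}"
  have finG: "finite G" by (simp add: G_def)
  have inG: "card {i \<in> T. \<omega> i \<in> B} \<in> G" if "q_hat (card T) \<beta> (card {i \<in> T. \<omega> i \<in> B}) < prob B" for \<omega>
    unfolding G_def using binomial_cdf_less_if_q_hat_less[OF _ \<beta> prob_le_1 that] T
    by (simp add: card_mono)
  show ?thesis
  proof (cases "G = {}")
    case True
    then show ?thesis using inG by (intro that[of "{}"]) auto
  next
    case False
    let ?E = "{\<omega> \<in> space (Pi\<^sub>M T (\<lambda>_. M)). card {i \<in> T. \<omega> i \<in> B} \<le> Max G}"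
    have "Max G \<in> G" using finG False by (rule Max_in)
    then have "P.prob ?E \<le> \<beta>" using prob_card_hits_le(2)[OF T B, of "Max G"] by (simp add: G_def)
    then have "emeasure (Pi\<^sub>M T (\<lambda>_. M)) ?E \<le> ennreal \<beta>"
      by (simp add: P.emeasure_eq_measure ennreal_leI)
    then show ?thesis
      using prob_card_hits_le(1)[OF T B] inG finG by (intro that[of ?E]) auto
  qed
qed

section \<open>From misfits of the model to the joint spectral radius\<close>

lemma quad_norm_triangle:
  fixes P :: "real^'n^'n"
  assumes feas: "quad_feasible \<delta> P"
  shows "quad_norm P (x + y) \<le> quad_norm P x + quad_norm P y"
proof -
  obtain R M :: "real^'n^'n" where P: "P = transpose R ** R"
    using pos_def_gram_factorization[OF quad_feasible_bounds(1,4)[OF feas]] by blast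
  show ?thesis by (simp only: P quad_norm_gram matrix_vector_right_distrib norm_triangle_ineq)
qed

text \<open>The error \<open>e\<close> is Euclidean; measuring it in the \<open>P\<close>-norm costs \<open>sqrt (lambda_max P)\<close>, and dividing by the
  \<open>P\<close>-norm of the unit vector \<open>x\<close> at most \<open>1 / sqrt (lambda_min P)\<close>. The product is \<open>sqrt (kappa_bar P)\<close>.\<close>
lemma quad_norm_model_error:
  fixes P A A' :: "real^'n^'n"
  assumes feas: "quad_feasible \<delta> P" and fin: "finite \<B>" and A': "A' \<in> \<B>"
    and x: "norm x = 1" and err: "norm (A *v x - A' *v x) \<le> e"
  shows "quad_norm P (A *v x) \<le> (quad_gain P \<B> + e * sqrt (kappa_bar P)) * quad_norm P x"
proof -
  have l: "1 \<le> lambda_min P" by (rule lambda_min_ge_1[OF feas])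
  have "lambda_min P \<le> lambda_max P"
    using rayleigh_bounds(2,3)[OF quad_feasible_bounds(1)[OF feas], of x] x
    by (simp add: power2_norm_eq_inner[symmetric])
  then have s: "sqrt (lambda_max P) = sqrt (kappa_bar P) * sqrt (lambda_min P)" "0 \<le> lambda_max P"
    using l by (auto simp: kappa_bar_def real_sqrt_mult[symmetric])
  have e: "0 \<le> e" using err norm_ge_zero order_trans by blast
  have "quad_norm P (A *v x) = quad_norm P (A' *v x + (A *v x - A' *v x))" by simp
  also have "\<dots> \<le> quad_norm P (A' *v x) + quad_norm P (A *v x - A' *v x)"
    by (rule quad_norm_triangle[OF feas])
  also have "\<dots> \<le> quad_gain P \<B> * quad_norm P x + sqrt (lambda_max P) * e"
  proof (rule add_mono)
    show "quad_norm P (A' *v x) \<le> quad_gain P \<B> * quad_norm P x"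
      by (rule quad_norm_le_gain[OF feas fin A'])
    show "quad_norm P (A *v x - A' *v x) \<le> sqrt (lambda_max P) * e"
      using quad_norm_lambda_bounds(2)[OF feas, of "A *v x - A' *v x"] err s(2)
      by (meson mult_left_mono order_trans real_sqrt_ge_zero)
  qed
  also have "sqrt (lambda_max P) * e = e * sqrt (kappa_bar P) * (sqrt (lambda_min P) * norm x)"
    by (simp add: s(1) x)
  also have "\<dots> \<le> e * sqrt (kappa_bar P) * quad_norm P x"
    using e s l quad_norm_lambda_bounds(1)[OF feas, of x]
    by (intro mult_left_mono) (auto simp: kappa_bar_def)
  finally show ?thesis by (simp add: algebra_simps)
qed

text \<open>The samples that the test counts as violations, as a set of triples rather than of data points, so that
  it is an event of the sampling distribution once the model is fixed.\<close>
definition misfit_set ::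
  "nat \<Rightarrow> real \<Rightarrow> (nat \<Rightarrow> real^'n^'n) \<Rightarrow> (nat \<Rightarrow> real^'n^'n) \<Rightarrow> ((real^'n) \<times> nat \<times> (real^'n)) set" where
  "misfit_set m \<epsilon> A Ahat =
     {(x, j, w). Min ((\<lambda>k. norm (Ahat k *v x - (A j *v x + w))) ` {1..m}) > \<epsilon>}"

lemma prob_space_sample_measure:
  assumes "prob_space \<mu>mode" "prob_space \<mu>noise"
  shows "prob_space (sample_measure \<mu>mode (\<mu>noise :: (real^'n) measure))"
proof -
  interpret S: prob_space "uniform_sphere :: (real^'n) measure" by (rule prob_space_uniform_sphere)
  interpret mo: prob_space \<mu>mode by fact
  interpret no: prob_space \<mu>noise by fact
  interpret mn: pair_prob_space \<mu>mode \<mu>noise ..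
  interpret smn: pair_prob_space "uniform_sphere :: (real^'n) measure" "\<mu>mode \<Otimes>\<^sub>M \<mu>noise" ..
  show ?thesis unfolding sample_measure_def by (rule smn.prob_space_axioms)
qed

lemma misfit_set_measurable:
  fixes \<mu>noise :: "(real^'n) measure"
  assumes m: "1 \<le> m" and mode: "sets \<mu>mode = sets (count_space {1..m})"
    and noise: "sets \<mu>noise = sets (restrict_space borel \<W>)"
  shows "misfit_set m \<epsilon> A Ahat \<inter> space (sample_measure \<mu>mode \<mu>noise) \<in> sets (sample_measure \<mu>mode \<mu>noise)"
proof -
  let ?M = "sample_measure \<mu>mode \<mu>noise"
  have x[measurable]: "fst \<in> borel_measurable ?M"
  proof -
    have "(\<lambda>x. x) \<in> borel_measurable (uniform_sphere :: (real^'n) measure)"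
      unfolding measurable_cong_sets[OF sets_uniform_sphere refl]
      by (rule measurable_restrict_space1) simp
    then show ?thesis unfolding sample_measure_def by (rule measurable_compose[OF measurable_fst])
  qed
  have j[measurable]: "(\<lambda>s. fst (snd s)) \<in> measurable ?M (count_space UNIV)"
  proof -
    have "(\<lambda>j. j) \<in> measurable \<mu>mode (count_space UNIV)"
      unfolding measurable_cong_sets[OF mode refl] by simp
    then show ?thesis unfolding sample_measure_def
      by (rule measurable_compose[OF measurable_compose[OF measurable_snd measurable_fst]])
  qed
  have w[measurable]: "(\<lambda>s. snd (snd s)) \<in> borel_measurable ?M"
  proof -
    have "(\<lambda>w. w) \<in> borel_measurable \<mu>noise"
      unfolding measurable_cong_sets[OF noise refl] by (rule measurable_restrict_space1) simp
    then show ?thesis unfolding sample_measure_def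
      by (rule measurable_compose[OF measurable_compose[OF measurable_snd measurable_snd]])
  qed
  have lin: "(\<lambda>s. C *v fst s) \<in> borel_measurable ?M" for C :: "real^'n^'n"
    by (rule measurable_compose[OF x])
       (intro borel_measurable_continuous_onI matrix_vector_mult_linear_continuous_on)
  have [measurable]: "(\<lambda>s. A (fst (snd s)) *v fst s) \<in> borel_measurable ?M"
    by (rule measurable_compose_countable[OF lin j])
  have [measurable]: "(\<lambda>s. norm (Ahat k *v fst s - (A (fst (snd s)) *v fst s + snd (snd s)))) \<in> borel_measurable ?M" for k
    using lin[of "Ahat k"] by measurable
  have "misfit_set m \<epsilon> A Ahat \<inter> space ?M =
      {s \<in> space ?M. \<forall>k\<in>{1..m}. \<epsilon> < norm (Ahat k *v fst s - (A (fst (snd s)) *v fst s + snd (snd s)))}"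
    using m by (auto simp: misfit_set_def Min_gr_iff)
  also have "\<dots> \<in> sets ?M" by measurable
  finally show ?thesis .
qed

text \<open>Let \<open>x\<close> violate the bound \<open>L\<close> for mode \<open>j\<close>. Then no learned matrix is within \<open>\<epsilon> + W\<close> of \<open>A j\<close> at
  \<open>x\<close>, so \<open>x\<close> with mode \<open>j\<close> and any noise of norm at most \<open>W\<close> is a misfit. By independence of the three
  components, such samples have probability at least the measure of violating directions times \<open>\<alpha> (1 - pW)\<close>.\<close>
lemma violating_directions_le_misfit:
  fixes \<mu>noise :: "(real^'n) measure" and A Ahat :: "nat \<Rightarrow> real^'n^'n"
  assumes m: "1 \<le> m" and mode: "prob_space \<mu>mode" "sets \<mu>mode = sets (count_space {1..m})"
    and noise: "prob_space \<mu>noise" "sets \<mu>noise = sets (restrict_space borel \<W>)"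
    and \<alpha>: "0 < \<alpha>" "\<alpha> \<le> measure \<mu>mode {j}" and j: "j \<in> {1..m}"
    and pW: "measure \<mu>noise {w \<in> \<W>. norm w > W} \<le> pW" "pW \<le> 1"
    and feas: "quad_feasible \<delta> P"
    and L: "L = quad_gain P (Ahat ` {1..m}) + (\<epsilon> + W) * sqrt (kappa_bar P)"
  shows "measure uniform_sphere {x \<in> sphere 0 1. L * quad_norm P x < quad_norm P (A j *v x)} * (\<alpha> * (1 - pW)) \<le>
    measure (sample_measure \<mu>mode \<mu>noise) (misfit_set m \<epsilon> A Ahat \<inter> space (sample_measure \<mu>mode \<mu>noise))"
proof -
  interpret S: prob_space "uniform_sphere :: (real^'n) measure" by (rule prob_space_uniform_sphere)
  interpret mo: prob_space \<mu>mode by fact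
  interpret no: prob_space \<mu>noise by fact
  interpret mn: pair_prob_space \<mu>mode \<mu>noise ..
  let ?M = "sample_measure \<mu>mode \<mu>noise"
  interpret M: prob_space ?M by (rule prob_space_sample_measure[OF mode(1) noise(1)])
  define C where "C = {x \<in> sphere 0 1. L * quad_norm P x < quad_norm P (A j *v x)}"
  define D where "D = {w \<in> \<W>. norm w \<le> W}"
  have spmode: "space \<mu>mode = {1..m}" using sets_eq_imp_space_eq[OF mode(2)] by simp
  have spnoise: "space \<mu>noise = \<W>" using sets_eq_imp_space_eq[OF noise(2)] by (simp add: space_restrict_space)
  have C: "C \<in> sets uniform_sphere"
  proof -
    have [measurable]: "(\<lambda>x. quad_norm P x) \<in> borel_measurable borel"
      using borel_measurable_quad_norm[of P "mat 1"] by simp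
    have "{x \<in> space borel. L * quad_norm P x < quad_norm P (A j *v x)} \<in> sets borel"
      by measurable
    then have "sphere 0 1 \<inter> {x \<in> space borel. L * quad_norm P x < quad_norm P (A j *v x)} \<in> sets uniform_sphere"
      unfolding sets_uniform_sphere sets_restrict_space by blast
    also have "sphere 0 1 \<inter> {x \<in> space borel. L * quad_norm P x < quad_norm P (A j *v x)} = C"
      by (auto simp: C_def)
    finally show ?thesis .
  qed
  have jset: "{j} \<in> sets \<mu>mode" using j by (simp add: mode(2))
  have Wset: "{w \<in> \<W>. norm w > W} \<in> sets \<mu>noise"
  proof -
    have "{w \<in> space borel. norm (w :: real^'n) > W} \<in> sets borel" by measurable
    then have "\<W> \<inter> {w \<in> space borel. norm w > W} \<in> sets \<mu>noise"
      unfolding noise(2) sets_restrict_space by blast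
    also have "\<W> \<inter> {w \<in> space borel. norm w > W} = {w \<in> \<W>. norm w > W}" by auto
    finally show ?thesis .
  qed
  have Dc: "D = space \<mu>noise - {w \<in> \<W>. norm w > W}" by (auto simp: D_def spnoise)
  have D: "D \<in> sets \<mu>noise" unfolding Dc using Wset by auto
  have "1 - pW \<le> no.prob D" using pW(1) unfolding Dc no.prob_compl[OF Wset] by simp
  have jD: "{j} \<times> D \<in> sets (\<mu>mode \<Otimes>\<^sub>M \<mu>noise)" using jset D by (rule pair_measureI)
  have prod: "M.prob (C \<times> ({j} \<times> D)) = S.prob C * (mo.prob {j} * no.prob D)"
    unfolding measure_def sample_measure_def mn.emeasure_pair_measure_Times[OF C jD]
      no.emeasure_pair_measure_Times[OF jset D] by (simp add: enn2real_mult)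
  have sub: "C \<times> ({j} \<times> D) \<subseteq> misfit_set m \<epsilon> A Ahat \<inter> space ?M"
  proof
    fix s assume "s \<in> C \<times> ({j} \<times> D)"
    then obtain x w where s: "s = (x, j, w)" "x \<in> C" "w \<in> D" by auto
    have x: "norm x = 1" "L * quad_norm P x < quad_norm P (A j *v x)" using s(2) by (auto simp: C_def)
    have "\<epsilon> < norm (Ahat k *v x - (A j *v x + w))" if k: "k \<in> {1..m}" for k
    proof (rule ccontr)
      assume "\<not> ?thesis"
      moreover have "norm w \<le> W" using s(3) by (simp add: D_def)
      moreover have "A j *v x - Ahat k *v x = - (Ahat k *v x - (A j *v x + w)) - w" by simp
      ultimately have "norm (A j *v x - Ahat k *v x) \<le> \<epsilon> + W"
        using norm_triangle_ineq4[of "- (Ahat k *v x - (A j *v x + w))" w]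
        by (simp only: norm_minus_cancel)
      then have "quad_norm P (A j *v x) \<le> L * quad_norm P x"
        unfolding L using k by (intro quad_norm_model_error[OF feas _ _ x(1), of _ "Ahat k"]) auto
      then show False using x(2) by simp
    qed
    then have "s \<in> misfit_set m \<epsilon> A Ahat" using m by (simp add: s(1) misfit_set_def Min_gr_iff)
    moreover have "s \<in> space ?M"
      using x s j by (simp add: sample_measure_def space_pair_measure spmode spnoise D_def)
    ultimately show "s \<in> misfit_set m \<epsilon> A Ahat \<inter> space ?M" by simp
  qed
  have "S.prob C * (\<alpha> * (1 - pW)) \<le> S.prob C * (mo.prob {j} * no.prob D)"
    using \<alpha> pW(2) \<open>1 - pW \<le> no.prob D\<close> by (intro mult_left_mono mult_mono) auto
  also have "\<dots> = M.prob (C \<times> ({j} \<times> D))" by (rule prod[symmetric])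
  also have "\<dots> \<le> M.prob (misfit_set m \<epsilon> A Ahat \<inter> space ?M)"
    by (rule M.finite_measure_mono[OF sub misfit_set_measurable[OF m mode(2) noise(2)]])
  finally show ?thesis by (simp add: C_def)
qed

text \<open>The deterministic half of the theorem: any upper bound \<open>q\<close> on the misfit probability of the model gives a
  valid certificate as long as the argument of \<open>zeta\<close> stays below \<open>1 / 2\<close>.\<close>
lemma joint_spectral_radius_le_of_misfit:
  fixes \<mu>noise :: "(real^'n) measure" and A Ahat :: "nat \<Rightarrow> real^'n^'n"
  assumes n: "2 \<le> CARD('n)" and m: "1 \<le> m" and \<epsilon>: "0 < \<epsilon>" and \<delta>: "1 \<le> \<delta>" and W: "0 \<le> W"
    and mode: "prob_space \<mu>mode" "sets \<mu>mode = sets (count_space {1..m})"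
    and noise: "prob_space \<mu>noise" "sets \<mu>noise = sets (restrict_space borel \<W>)"
    and \<alpha>: "0 < \<alpha>" "\<And>j. j \<in> {1..m} \<Longrightarrow> \<alpha> \<le> measure \<mu>mode {j}"
    and pW: "measure \<mu>noise {w \<in> \<W>. norm w > W} \<le> pW" "pW < 1"
    and P: "rho_quad_minimizer (Ahat ` {1..m}) \<delta> P"
    and q: "measure (sample_measure \<mu>mode \<mu>noise) (misfit_set m \<epsilon> A Ahat \<inter> space (sample_measure \<mu>mode \<mu>noise)) \<le> q"
    and arg: "q / (2 * (1 - pW) * \<alpha>) * kappa P < 1 / 2"
  shows "joint_spectral_radius (A ` {1..m}) \<le>
    (rho_quad (Ahat ` {1..m}) \<delta> + (\<epsilon> + W) * sqrt (kappa_bar P)) / zeta CARD('n) (q / (2 * (1 - pW) * \<alpha>) * kappa P)"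
proof -
  let ?arg = "q / (2 * (1 - pW) * \<alpha>) * kappa P"
  have feas: "quad_feasible \<delta> P" using P by (simp add: rho_quad_minimizer_def)
  define L where "L = quad_gain P (Ahat ` {1..m}) + (\<epsilon> + W) * sqrt (kappa_bar P)"
  have l: "1 \<le> lambda_min P" by (rule lambda_min_ge_1[OF feas])
  obtain x0 :: "real^'n" where x0: "norm x0 = 1" using vector_choose_size zero_le_one by metis
  have qx0: "1 \<le> quad_norm P x0" using quad_norm_bounds(1)[OF feas, of x0] x0 by simp
  have "0 \<le> quad_gain P (Ahat ` {1..m}) * quad_norm P x0"
    using quad_norm_le_gain[OF feas, of "Ahat ` {1..m}" "Ahat 1" x0] quad_norm_nonneg[OF feas] m
    by (meson atLeastAtMost_iff finite_atLeastAtMost finite_imageI imageI order_refl order_trans)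
  then have gain: "0 \<le> quad_gain P (Ahat ` {1..m})" using qx0 by (simp add: zero_le_mult_iff)
  have "lambda_min P \<le> lambda_max P"
    using rayleigh_bounds(2,3)[OF quad_feasible_bounds(1)[OF feas], of x0] x0
    by (simp add: power2_norm_eq_inner[symmetric])
  then have "0 < kappa_bar P" using l by (simp add: kappa_bar_def)
  then have "0 < (\<epsilon> + W) * sqrt (kappa_bar P)" using \<epsilon> W by simp
  then have L: "0 < L" unfolding L_def using gain by (rule add_nonneg_pos[rotated])
  have kappa: "0 \<le> kappa P"
  proof -
    obtain R M :: "real^'n^'n" where "P = transpose R ** R"
      using pos_def_gram_factorization[OF quad_feasible_bounds(1,4)[OF feas]] by blast
    then have "0 \<le> det P" by (simp add: det_mul)
    then show ?thesis using l by (simp add: kappa_def)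
  qed
  have "0 \<le> q" using q measure_nonneg order_trans by blast
  then have arg0: "0 \<le> ?arg" using kappa \<alpha>(1) pW(2) by simp
  have contr: "quad_norm P (A j *v x) \<le> L / zeta CARD('n) ?arg * quad_norm P x" if j: "j \<in> {1..m}" for j x
  proof (rule quad_norm_le_of_rare_violations[OF n feas L arg0 arg])
    let ?C = "{x \<in> sphere 0 1. L * quad_norm P x < quad_norm P (A j *v x)}"
    have "measure uniform_sphere ?C * (\<alpha> * (1 - pW)) \<le> q"
      using violating_directions_le_misfit[OF m mode noise \<alpha>(1) \<alpha>(2)[OF j] j pW(1) _ feas L_def, of A] q pW(2)
      by simp
    then have "measure uniform_sphere ?C \<le> q / (\<alpha> * (1 - pW))"
      using \<alpha>(1) pW(2) by (simp add: pos_le_divide_eq)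
    then have "kappa P * measure uniform_sphere ?C \<le> kappa P * (q / (\<alpha> * (1 - pW)))"
      using kappa by (rule mult_left_mono)
    also have "\<dots> = 2 * ?arg" by (simp add: divide_simps)
    finally show "kappa P * measure uniform_sphere ?C \<le> 2 * ?arg" .
  qed
  obtain d where d: "CARD('n) = Suc d" "0 < d" using n by (cases "CARD('n)") auto
  have "0 < zeta CARD('n) ?arg" using zeta_cap_height(1)[OF d(2) arg0 arg] by (simp add: d(1))
  then have "joint_spectral_radius (A ` {1..m}) \<le> L / zeta CARD('n) ?arg"
    using L contr by (intro joint_spectral_radius_le[OF feas _ \<delta>]) auto
  then show ?thesis unfolding L_def quad_gain_minimizer[OF P] .
qed

theorem theorem15:
  fixes A :: "nat \<Rightarrow> real^'n^'n"
    and m N :: nat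
    and T :: "nat set"
    and \<W> :: "(real^'n) set"
    and \<mu>mode :: "nat measure"
    and \<mu>noise :: "(real^'n) measure"
    and p :: "real \<Rightarrow> real"
    and \<alpha> \<beta> \<epsilon> \<delta> W :: real
    and P0 :: "(real^'n^'n) set \<Rightarrow> real \<Rightarrow> real^'n^'n"
    and learn :: "(nat \<Rightarrow> (real^'n) \<times> (real^'n)) \<Rightarrow> nat \<Rightarrow> real^'n^'n"
  assumes "CARD('n) \<ge> 2" and "m \<ge> 1"
    and "0 < \<beta>" "\<beta> < 1" "0 < \<epsilon>" "1 \<le> \<delta>" "0 \<le> W"
    and "T \<subseteq> {1..N}" "card T \<ge> 1"
    and "prob_space \<mu>mode" "sets \<mu>mode = sets (count_space {1..m})"
    and "prob_space \<mu>noise" "sets \<mu>noise = sets (restrict_space borel \<W>)"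
    and "0 < \<alpha>" "\<And>j. j \<in> {1..m} \<Longrightarrow> \<alpha> \<le> measure \<mu>mode {j}"
    and "\<And>w. 0 \<le> w \<Longrightarrow> p w \<in> {0..1}"
    and "\<And>W'. 0 \<le> W' \<Longrightarrow> measure \<mu>noise {w \<in> \<W>. norm w > W'} \<le> p W'"
    and P0: "\<And>\<B>. finite \<B> \<Longrightarrow> \<B> \<noteq> {} \<Longrightarrow> rho_quad_minimizer \<B> \<delta> (P0 \<B> \<delta>)"
    and learn_measurable: "\<And>k. k \<in> {1..m} \<Longrightarrow>
          (\<lambda>\<omega>. learned_model N T learn (dataset N A \<omega>) k) \<in> borel_measurable (iid_samples N \<mu>mode \<mu>noise)"
    and output_measurable:
          "(\<lambda>\<omega>. certified_bound m N T learn P0 p \<alpha> \<beta> \<epsilon> \<delta> W (dataset N A \<omega>))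
             \<in> borel_measurable (iid_samples N \<mu>mode \<mu>noise)"
  shows "measure (iid_samples N \<mu>mode \<mu>noise)
           {\<omega> \<in> space (iid_samples N \<mu>mode \<mu>noise).
              ereal (joint_spectral_radius (A ` {1..m}))
                \<le> certified_bound m N T learn P0 p \<alpha> \<beta> \<epsilon> \<delta> W (dataset N A \<omega>)}
         \<ge> 1 - \<beta>"
proof -
  let ?M = "sample_measure \<mu>mode \<mu>noise"
  let ?\<Omega> = "iid_samples N \<mu>mode \<mu>noise"
  let ?bound = "\<lambda>\<omega>. certified_bound m N T learn P0 p \<alpha> \<beta> \<epsilon> \<delta> W (dataset N A \<omega>)"
  let ?\<rho> = "joint_spectral_radius (A ` {1..m})"
  define J where "J = {1..N} - T"
  have T: "finite T" using assms(8) finite_subset by blast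
  have JT: "J \<inter> T = {}" "J \<union> T = {1..N}" "finite J" using assms(8) by (auto simp: J_def)
  interpret M: prob_space ?M by (rule prob_space_sample_measure[OF assms(10,12)])
  interpret prod: product_sigma_finite "\<lambda>_ :: nat. ?M" ..
  interpret \<Omega>: finite_product_prob_space "\<lambda>_ :: nat. ?M" "{1..N}" by standard simp
  interpret J: finite_product_prob_space "\<lambda>_ :: nat. ?M" J by standard (rule JT)
  have \<Omega>: "?\<Omega> = Pi\<^sub>M (J \<union> T) (\<lambda>_. ?M)" by (simp add: iid_samples_def JT)
  define bad where "bad = {\<omega> \<in> space ?\<Omega>. \<not> ereal ?\<rho> \<le> ?bound \<omega>}"
  have good_sets: "{\<omega> \<in> space ?\<Omega>. ereal ?\<rho> \<le> ?bound \<omega>} \<in> sets ?\<Omega>"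
    using output_measurable by measurable
  have bad_compl: "bad = space ?\<Omega> - {\<omega> \<in> space ?\<Omega>. ereal ?\<rho> \<le> ?bound \<omega>}" by (auto simp: bad_def)
  have bad_sets: "bad \<in> sets ?\<Omega>" unfolding bad_compl using good_sets by auto
  \<comment> \<open>Given the training part \<open>\<omega>1\<close>, the model is fixed and the test part \<open>\<omega>2\<close> is an i.i.d. sample for it.\<close>
  have test_part: "(\<integral>\<^sup>+\<omega>2. indicator bad (merge J T (\<omega>1, \<omega>2)) \<partial>Pi\<^sub>M T (\<lambda>_. ?M)) \<le> ennreal \<beta>" for \<omega>1
  proof -
    define Ahat where "Ahat = learn (\<lambda>i\<in>J. case \<omega>1 i of (x, j, w) \<Rightarrow> (x, A j *v x + w))"
    define B where "B = misfit_set m \<epsilon> A Ahat \<inter> space ?M"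
    have B: "B \<in> M.events" unfolding B_def by (rule misfit_set_measurable[OF assms(2,11,13)])
    obtain E where E: "E \<in> sets (Pi\<^sub>M T (\<lambda>_. ?M))" "emeasure (Pi\<^sub>M T (\<lambda>_. ?M)) E \<le> ennreal \<beta>"
      "\<And>\<omega>. \<omega> \<in> space (Pi\<^sub>M T (\<lambda>_. ?M)) \<Longrightarrow> q_hat (card T) \<beta> (card {i \<in> T. \<omega> i \<in> B}) < M.prob B \<Longrightarrow> \<omega> \<in> E"
      using M.clopper_pearson[OF T B assms(3,4)] by blast
    have "merge J T (\<omega>1, \<omega>2) \<notin> bad" if \<omega>2: "\<omega>2 \<in> space (Pi\<^sub>M T (\<lambda>_. ?M))" "\<omega>2 \<notin> E" for \<omega>2
    proof -
      define \<omega> where "\<omega> = merge J T (\<omega>1, \<omega>2)"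
      have \<omega>J: "\<omega> i = \<omega>1 i" if "i \<in> J" for i using that JT by (simp add: \<omega>_def merge_def)
      have \<omega>T: "\<omega> i = \<omega>2 i" if "i \<in> T" for i using that JT by (auto simp: \<omega>_def merge_def)
      have "restrict (dataset N A \<omega>) J = (\<lambda>i\<in>J. case \<omega>1 i of (x, j, w) \<Rightarrow> (x, A j *v x + w))"
        using \<omega>J by (auto simp: dataset_def J_def restrict_def)
      then have model: "learned_model N T learn (dataset N A \<omega>) = Ahat"
        unfolding learned_model_def Ahat_def J_def[symmetric] by (simp only:)
      have "{i \<in> T. Min ((\<lambda>k. norm (Ahat k *v fst (dataset N A \<omega> i) - snd (dataset N A \<omega> i))) ` {1..m}) > \<epsilon>} =
          {i \<in> T. \<omega>2 i \<in> B}"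
      proof (rule Collect_cong, rule conj_cong[OF refl])
        fix i assume i: "i \<in> T"
        obtain x j w where s: "\<omega>2 i = (x, j, w)" by (cases "\<omega>2 i")
        have "\<omega>2 i \<in> space ?M" using \<omega>2(1) i by (auto simp: space_PiM)
        moreover have "dataset N A \<omega> i = (x, A j *v x + w)"
          using i assms(8) \<omega>T[OF i] by (auto simp: dataset_def s)
        ultimately show "(Min ((\<lambda>k. norm (Ahat k *v fst (dataset N A \<omega> i) - snd (dataset N A \<omega> i))) ` {1..m}) > \<epsilon>) =
            (\<omega>2 i \<in> B)"
          by (simp add: B_def misfit_set_def s)
      qed
      then have count: "violation_count m T \<epsilon> Ahat (dataset N A \<omega>) = card {i \<in> T. \<omega>2 i \<in> B}"
        by (simp add: violation_count_def)
      define q where "q = q_hat (card T) \<beta> (card {i \<in> T. \<omega>2 i \<in> B})"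
      have q: "M.prob B \<le> q" using E(3)[OF \<omega>2(1)] \<omega>2(2) by (force simp: q_def)
      define P where "P = P0 (Ahat ` {1..m}) \<delta>"
      have P: "rho_quad_minimizer (Ahat ` {1..m}) \<delta> P" unfolding P_def by (rule P0) (use assms(2) in auto)
      have "ereal ?\<rho> \<le> ?bound \<omega>"
      proof (cases "p W = 1 \<or> q / (2 * (1 - p W) * \<alpha>) * kappa P \<ge> 1 / 2")
        case True
        then show ?thesis unfolding certified_bound_def Let_def model count q_def[symmetric] P_def[symmetric] by simp
      next
        case False
        then have pW: "p W < 1" and arg: "q / (2 * (1 - p W) * \<alpha>) * kappa P < 1 / 2"
          using assms(16)[OF assms(7)] by auto
        have "?\<rho> \<le> (rho_quad (Ahat ` {1..m}) \<delta> + (\<epsilon> + W) * sqrt (kappa_bar P)) /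
            zeta CARD('n) (q / (2 * (1 - p W) * \<alpha>) * kappa P)"
          by (rule joint_spectral_radius_le_of_misfit[OF assms(1,2,5,6,7,10,11,12,13,14,15) assms(17)[OF assms(7)] pW P
                q[unfolded B_def] arg])
        then show ?thesis
          using False unfolding certified_bound_def Let_def model count q_def[symmetric] P_def[symmetric] by simp
      qed
      then show ?thesis by (simp add: bad_def \<omega>_def)
    qed
    then have "(\<integral>\<^sup>+\<omega>2. indicator bad (merge J T (\<omega>1, \<omega>2)) \<partial>Pi\<^sub>M T (\<lambda>_. ?M)) \<le>
        (\<integral>\<^sup>+\<omega>2. indicator E \<omega>2 \<partial>Pi\<^sub>M T (\<lambda>_. ?M))"
      by (intro nn_integral_mono) (auto simp: indicator_def)
    also have "\<dots> = emeasure (Pi\<^sub>M T (\<lambda>_. ?M)) E" using E(1) by simp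
    finally show ?thesis using E(2) by simp
  qed
  \<comment> \<open>Fubini over the training and the test part.\<close>
  have "emeasure ?\<Omega> bad = (\<integral>\<^sup>+\<omega>. indicator bad \<omega> \<partial>?\<Omega>)" using bad_sets by simp
  also have "\<dots> = (\<integral>\<^sup>+\<omega>1. \<integral>\<^sup>+\<omega>2. indicator bad (merge J T (\<omega>1, \<omega>2)) \<partial>Pi\<^sub>M T (\<lambda>_. ?M) \<partial>Pi\<^sub>M J (\<lambda>_. ?M))"
    unfolding \<Omega> by (rule prod.product_nn_integral_fold[OF JT(1,3) T]) (use bad_sets \<Omega> in simp)
  also have "\<dots> \<le> (\<integral>\<^sup>+\<omega>1. ennreal \<beta> \<partial>Pi\<^sub>M J (\<lambda>_. ?M))"
    by (intro nn_integral_mono test_part)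
  also have "\<dots> = ennreal \<beta>" by (simp add: J.emeasure_space_1)
  finally have "emeasure ?\<Omega> bad \<le> ennreal \<beta>" .
  moreover have P\<Omega>: "prob_space ?\<Omega>" unfolding iid_samples_def by (rule \<Omega>.prob_space_axioms)
  ultimately have "measure ?\<Omega> bad \<le> \<beta>"
    using assms(3) by (simp add: finite_measure.emeasure_eq_measure[OF prob_space.finite_measure[OF P\<Omega>]])
  then show ?thesis
    unfolding bad_compl using prob_space.prob_compl[OF P\<Omega> good_sets] by simp
qed

end
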